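(* Let $\beta\in\mathbb{R}$. If $f\in\mathcal{A}$ satisfies $$1+\beta\left(1-\frac{zf'(z)}{f(z)}+\frac{zf''(z)}{f'(z)}\right)\prec\varphi_{Ne}(z)=1+z-\frac{z^3}{3},$$ then (a) $f\in\mathcal{S}^*_{S}$ whenever $\beta\geq\frac{8/9}{\log(1+\sin1)}$. (b) $f\in\mathcal{S}^*_{R}$ whenever $\beta\geq-\frac{8/9}{\log(2\sqrt{2}-2)}$. (c) $f\in\mathcal{S}^*_{Ne}$ whenever $\beta\geq\frac{8/9}{\log(5/3)}$. The bounds on $\beta$ are best possible, i.e. in each part the lower bound on $\beta$ cannot be replaced by a smaller number.
   Context: $\mathbb{D}$ is the open unit disk. $\mathcal{A}$ is the set of analytic functions $f$ on $\mathbb{D}$ with $f(0)=0$ and $f'(0)=1$. For analytic $f,g$ on $\mathbb{D}$, $f\prec g$ means there is an analytic $w$ on $\mathbb{D}$ with $w(0)=0$, $|w(z)|<1$ and $f(z)=g(w(z))$ on $\mathbb{D}$; the left-hand side of the hypothesis is understood to be analytic on $\mathbb{D}$ (after removing removable singularities). For analytic $\varphi$ with $\varphi(0)=1$, $\mathcal{S}^*(\varphi)=\{f\in\mathcal{A}: zf'(z)/f(z)\prec\varphi(z)\}$. Then $\mathcal{S}^*_S=\mathcal{S}^*(1+\sin z)$, $\mathcal{S}^*_R=\mathcal{S}^*\left(1+\frac{z}{k}\frac{k+z}{k-z}\right)$ with $k=1+\sqrt2$, and $\mathcal{S}^*_{Ne}=\mathcal{S}^*(1+z-z^3/3)$. 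*)

theory Defs
  imports "HOL-Complex_Analysis.Complex_Analysis"
begin

abbreviation unit_disk :: "complex set" where
  "unit_disk \<equiv> ball 0 1"

definition class_A :: "(complex \<Rightarrow> complex) set" where
  "class_A = {f. f holomorphic_on unit_disk \<and> f 0 = 0 \<and> deriv f 0 = 1}"

definition subordinate :: "(complex \<Rightarrow> complex) \<Rightarrow> (complex \<Rightarrow> complex) \<Rightarrow> bool" where
  "subordinate f g \<longleftrightarrow>
     f holomorphic_on unit_disk \<and> g holomorphic_on unit_disk \<and>
     (\<exists>w. w holomorphic_on unit_disk \<and> w 0 = 0 \<and>
          (\<forall>z\<in>unit_disk. norm (w z) < 1) \<and> (\<forall>z\<in>unit_disk. f z = g (w z)))"

text \<open>
  The quotients below are formed with the total division of HOL, so they have no meaning at the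
  zeros of the denominators (in particular at the origin, where \<open>f 0 = 0\<close>).  For \<open>f\<close> in
  \<open>class_A\<close> these zeros are isolated in the disk, and \<open>remove_sings\<close> replaces the values there
  by the limits.  If one of these points is a pole, the resulting function is not
  holomorphic on the disk, and hence \<open>subordinate\<close> fails.
\<close>

definition starlike_class :: "(complex \<Rightarrow> complex) \<Rightarrow> (complex \<Rightarrow> complex) set" where
  "starlike_class \<phi> =
     {f \<in> class_A. subordinate (remove_sings (\<lambda>z. z * deriv f z / f z)) \<phi>}"

definition beta_expr :: "real \<Rightarrow> (complex \<Rightarrow> complex) \<Rightarrow> complex \<Rightarrow> complex" where
  "beta_expr \<beta> f =
     remove_sings (\<lambda>z. 1 + of_real \<beta> *
       (1 - z * deriv f z / f z + z * deriv (deriv f) z / deriv f z))"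

definition phi_S :: "complex \<Rightarrow> complex" where
  "phi_S z = 1 + sin z"

definition phi_R :: "complex \<Rightarrow> complex" where
  "phi_R z = (let k = of_real (1 + sqrt 2) in 1 + z / k * ((k + z) / (k - z)))"

definition phi_Ne :: "complex \<Rightarrow> complex" where
  "phi_Ne z = 1 + z - z ^ 3 / 3"

definition bound_S :: real where
  "bound_S = (8 / 9) / ln (1 + sin 1)"

definition bound_R :: real where
  "bound_R = - ((8 / 9) / ln (2 * sqrt 2 - 2))"

definition bound_Ne :: real where
  "bound_Ne = (8 / 9) / ln (5 / 3)"

end

theory Submission
  imports Defs
begin

text \<open>
  With \<open>p = z f' / f\<close> the hypothesis reads \<open>\<beta> z p' / p = h (w z)\<close>, where \<open>h z = z - z^3 / 3\<close> is starlike
  and \<open>z Q' = h\<close> for \<open>Q z = z - z^3 / 9\<close>. If \<open>G = log p\<close> left \<open>\<mu> Q (D)\<close> for some \<open>\<mu> \<ge> 1 / \<beta>\<close>, then at a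
  first exit point Jack's lemma would give \<open>z G' = m \<mu> h \<zeta>\<close> with \<open>m \<ge> 1\<close> and \<open>norm \<zeta> = 1\<close>, against
  the starlikeness of \<open>h\<close>; hence \<open>p\<close> takes values in \<open>exp (\<mu> Q (D))\<close>. Taking for \<open>\<mu>\<close> the reciprocal of
  the bound, the moduli of the points of this region stay strictly between those of its real
  extreme points \<open>exp (\<plusminus> 8 \<mu> / 9)\<close>. Modulus together with crude control of the argument already shows
  that the region misses \<open>\<phi>\<close> of the unit circle, and being connected it lies in \<open>\<phi> (D)\<close>. The bound is
  attained because one of the two real extreme points is \<open>\<phi> 1\<close> or \<open>\<phi> (-1)\<close>.
\<close>

section \<open>Subordination and the multiplier at the boundary\<close>

lemma subordinate_by_image:
  assumes P: "P holomorphic_on ball 0 1" and phi: "\<phi> holomorphic_on ball 0 1"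
    and inj: "inj_on \<phi> (ball 0 1)" and P0: "P 0 = \<phi> 0"
    and sub: "P ` ball 0 1 \<subseteq> \<phi> ` ball 0 1"
  shows "subordinate P \<phi>"
proof -
  obtain \<psi> where \<psi>: "\<psi> holomorphic_on \<phi> ` ball 0 1"
    and inv: "\<And>z. z \<in> ball 0 1 \<Longrightarrow> \<psi> (\<phi> z) = z"
    using holomorphic_has_inverse[OF phi open_ball inj] by metis
  have "(\<psi> \<circ> P) holomorphic_on ball 0 1"
    by (rule holomorphic_on_compose_gen[OF P \<psi> sub])
  moreover have "(\<psi> \<circ> P) 0 = 0"
    using inv[of 0] by (simp add: P0)
  moreover have "norm ((\<psi> \<circ> P) z) < 1 \<and> P z = \<phi> ((\<psi> \<circ> P) z)" if "z \<in> ball 0 1" for z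
  proof -
    have "P z \<in> \<phi> ` ball 0 1"
      by (rule subsetD[OF sub imageI[OF that]])
    then obtain u where "u \<in> ball 0 1" "P z = \<phi> u"
      by (rule imageE)
    then show ?thesis using inv by simp
  qed
  ultimately show ?thesis
    unfolding subordinate_def using P phi by blast
qed

text \<open>Since \<open>g\<close> misses the \<open>\<phi>\<close>-image of the circle, its
  connected range meets the open set \<open>\<phi>\<close> ball 0
  1\<open>and the compact set\<close>\<phi> \<open>cball 0 1\<close> in the same points. That
  intersection is clopen in the range and contains \<open>\<phi> 0\<close>.\<close>

lemma image_subset_if_avoids_boundary:
  fixes g \<phi> :: "complex \<Rightarrow> complex"
  assumes g: "continuous_on (ball 0 1) g"
    and phi: "\<phi> holomorphic_on ball 0 1" "continuous_on (cball 0 1) \<phi>"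
    and inj: "inj_on \<phi> (ball 0 1)" and g0: "g 0 = \<phi> 0"
    and avoid: "\<And>v \<zeta>. norm v < 1 \<Longrightarrow> norm \<zeta> = 1 \<Longrightarrow> g v \<noteq> \<phi> \<zeta>"
  shows "g ` ball 0 1 \<subseteq> \<phi> ` ball 0 1"
proof -
  let ?S = "g ` ball 0 1"
  have "connected ?S"
    using connected_continuous_image[OF g] by simp
  have "open (\<phi> ` ball 0 1)"
    by (rule open_mapping_thm3[OF phi(1) open_ball inj])
  have "closed (\<phi> ` cball 0 1)"
    using compact_continuous_image[OF phi(2)] compact_imp_closed by auto
  have "?S \<inter> \<phi> ` cball 0 1 \<subseteq> \<phi> ` ball 0 1"
    using avoid by (force simp: less_eq_real_def)
  then have eq: "?S \<inter> \<phi> ` ball 0 1 = ?S \<inter> \<phi> ` cball 0 1"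
    by auto
  have "openin (top_of_set ?S) (?S \<inter> \<phi> ` ball 0 1)"
    using \<open>open (\<phi> ` ball 0 1)\<close> by (simp add: openin_open_Int)
  moreover have "closedin (top_of_set ?S) (?S \<inter> \<phi> ` ball 0 1)"
    unfolding eq using \<open>closed (\<phi> ` cball 0 1)\<close> by (simp add: closedin_closed_Int)
  moreover have "\<phi> 0 \<in> ?S \<inter> \<phi> ` ball 0 1"
    using g0 by (metis IntI centre_in_ball imageI zero_less_one)
  ultimately have "?S \<inter> \<phi> ` ball 0 1 = ?S"
    using \<open>connected ?S\<close> unfolding connected_clopen by blast
  then show ?thesis by blast
qed

text \<open>Comparing \<open>norm (W z)\<close> with \<open>norm z / r\<close> along every inward direction at the touching
  point gives both that the multiplier is real and that it is at least one.\<close>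

lemma jack_boundary_multiplier:
  fixes W :: "complex \<Rightarrow> complex"
  assumes W: "W holomorphic_on ball 0 r" "W 0 = 0" "\<And>z. norm z < r \<Longrightarrow> norm (W z) < 1"
    and z0: "norm z0 = r" "r > 0"
    and der: "(W has_field_derivative W') (at z0)" and W1: "norm (W z0) = 1"
  obtains m :: real where "m \<ge> 1" "z0 * W' = of_real m * W z0"
proof -
  have schwarz: "norm (W z) \<le> norm z / r" if "norm z < r" for z
  proof -
    have *: "(\<lambda>u. W (of_real r * u)) holomorphic_on ball 0 1"
    proof (rule holomorphic_on_compose_gen[of "\<lambda>u. of_real r * u" _ W "ball 0 r", unfolded o_def])
      show "(\<lambda>u. of_real r * u) ` ball 0 1 \<subseteq> ball (0::complex) r"
        using z0 by (auto simp: norm_mult)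
    qed (use W in \<open>auto intro!: holomorphic_intros\<close>)
    have "norm (W (of_real r * (z / of_real r))) \<le> norm (z / of_real r)"
      by (rule Schwarz_Lemma(1)[OF *])
        (use W z0 that in \<open>auto simp: norm_mult norm_divide\<close>)
    then show ?thesis using z0 by (simp add: norm_divide)
  qed
  define M where "M = cnj (W z0) * (z0 * W')"
  have key: "Re (M * Complex 1 \<kappa>) \<ge> 1" for \<kappa>
  proof (rule ccontr)
    assume neg: "\<not> Re (M * Complex 1 \<kappa>) \<ge> 1"
    define a where "a = Complex 1 \<kappa>"
    \<comment> \<open>Squared moduli are used to have differentiability at 0, with derivative
      \<open>2 * (1 - Re (M * a))\<close>. A positive derivative makes \<open>\<psi>\<close>
      positive just after \<open>\<psi> 0 = 0\<close>, whereas \<open>schwarz\<close> forces it to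
      be at most 0 inside the disk.\<close>
    define \<psi> where "\<psi> t = (norm (W (z0 * (1 - of_real t * a))))\<^sup>2 - (norm (1 - of_real t * a))\<^sup>2" for t
    have alt: "\<psi> = (\<lambda>t. W (z0 * (1 - of_real t * a)) \<bullet> W (z0 * (1 - of_real t * a))
                - (1 - of_real t * a) \<bullet> (1 - of_real t * a))"
      by (simp add: \<psi>_def fun_eq_iff power2_norm_eq_inner)
    have lin: "((\<lambda>t. z0 * (1 - of_real t * a)) has_vector_derivative - (z0 * a)) (at 0)"
      by (auto intro!: derivative_eq_intros simp: has_vector_derivative_def algebra_simps scaleR_conv_of_real)
    have dW: "((\<lambda>t. W (z0 * (1 - of_real t * a))) has_vector_derivative - (z0 * a) * W') (at 0)"
      using field_vector_diff_chain_at[OF lin, of W W'] der by (simp add: o_def)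
    have dl: "((\<lambda>t. 1 - of_real t * a) has_vector_derivative - a) (at 0)"
      by (auto intro!: derivative_eq_intros simp: has_vector_derivative_def scaleR_conv_of_real)
    have "(\<psi> has_vector_derivative
        (W z0 \<bullet> (- (z0 * a) * W') + (- (z0 * a) * W') \<bullet> W z0) - (1 \<bullet> (-a) + (-a) \<bullet> 1)) (at 0)"
      unfolding alt
      using has_vector_derivative_diff[OF
          bounded_bilinear.has_vector_derivative[OF bounded_bilinear_inner dW dW]
          bounded_bilinear.has_vector_derivative[OF bounded_bilinear_inner dl dl]]
      by simp
    moreover have "(W z0 \<bullet> (- (z0 * a) * W') + (- (z0 * a) * W') \<bullet> W z0) - (1 \<bullet> (-a) + (-a) \<bullet> 1)
        = 2 * (1 - Re (M * a))"
      by (simp add: M_def a_def inner_complex_def algebra_simps)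
    ultimately have "DERIV \<psi> 0 :> 2 * (1 - Re (M * a))"
      by (simp add: has_real_derivative_iff_has_vector_derivative)
    then obtain d where d: "d > 0" "\<And>h. h > 0 \<Longrightarrow> h < d \<Longrightarrow> \<psi> 0 < \<psi> h"
      using DERIV_pos_inc_right[of \<psi> "2 * (1 - Re (M * a))" 0] neg by (auto simp: a_def)
    \<comment> \<open>The second entry is the inverse of |a|^2; it gives |1 - t a|^2 <= 1 - t, so
      the point stays inside the disk of radius \<open>r\<close>.\<close>
    define t where "t = min (d/2) (1 / (1 + \<kappa>\<^sup>2))"
    have pos: "1 + \<kappa>\<^sup>2 > 0" by (simp add: add_pos_nonneg)
    have t: "t > 0" "t < d" using d(1) pos by (auto simp: t_def min_def)
    have "t * (1 + \<kappa>\<^sup>2) \<le> 1"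
      using pos by (auto simp: t_def min_def field_simps)
    then have "t * (t * (1 + \<kappa>\<^sup>2)) \<le> t" using t(1) by (simp add: mult_le_cancel_left1)
    moreover have "(norm (1 - of_real t * a))\<^sup>2 = 1 - 2 * t + t * (t * (1 + \<kappa>\<^sup>2))"
      unfolding cmod_power2 by (simp add: a_def power2_eq_square algebra_simps)
    ultimately have "(norm (1 - of_real t * a))\<^sup>2 < 1\<^sup>2" using t(1) by simp
    then have lt: "norm (1 - of_real t * a) < 1"
      by (rule power_less_imp_less_base) simp
    have "norm (W (z0 * (1 - of_real t * a))) \<le> norm (1 - of_real t * a)"
      using schwarz[of "z0 * (1 - of_real t * a)"] lt z0 by (simp add: norm_mult)
    then have "\<psi> t \<le> 0"
      unfolding \<psi>_def by (simp add: power_mono)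
    moreover have "\<psi> 0 = 0" by (simp add: \<psi>_def W1)
    ultimately show False using d(2)[OF t] by simp
  qed
  have Re: "Re M \<ge> 1" using key[of 0] by simp
  have Im: "Im M = 0"
  proof (rule ccontr)
    assume "Im M \<noteq> 0"
    \<comment> \<open>This direction makes \<open>M * Complex 1 \<kappa>\<close> purely
      imaginary.\<close>
    then show False using key[of "Re M / Im M"] by simp
  qed
  have "W z0 * M = z0 * W' * (W z0 * cnj (W z0))" by (simp add: M_def)
  also have "\<dots> = z0 * W'"
    by (simp only: complex_norm_square[symmetric]) (simp add: W1)
  finally have "z0 * W' = of_real (Re M) * W z0"
    using Im by (simp add: complex_eq_iff mult.commute)
  with Re show ?thesis by (rule that)
qed

text \<open>The radius \<open>R > 1\<close> of univalence lets the inverse of \<open>g\<close> be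
  applied on a neighbourhood of the first exit point, so \<open>W\<close>, the inverse of
  \<open>g\<close> after \<open>G\<close>, is differentiable there and Jack's lemma applies. The
  hypothesis \<open>adm\<close> excludes exactly the relation that it produces.\<close>

lemma miller_mocanu_subset:
  fixes g G :: "complex \<Rightarrow> complex"
  assumes G: "G holomorphic_on ball 0 1" and g: "g holomorphic_on ball 0 R" "R > 1"
    and inj: "inj_on g (ball 0 R)" and G0: "G 0 = g 0"
    and adm: "\<And>z \<zeta> m. norm z < 1 \<Longrightarrow> norm \<zeta> = 1 \<Longrightarrow> m \<ge> 1 \<Longrightarrow> G z = g \<zeta> \<Longrightarrow>
                z * deriv G z \<noteq> of_real m * (\<zeta> * deriv g \<zeta>)"
  shows "G ` ball 0 1 \<subseteq> g ` ball 0 1"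
proof (rule ccontr)
  assume "\<not> ?thesis"
  then obtain z1 where z1: "norm z1 < 1" "G z1 \<notin> g ` ball 0 1"
    by (auto simp: image_subset_iff)
  have sub: "ball 0 1 \<subseteq> ball (0::complex) R" "cball 0 1 \<subseteq> ball (0::complex) R"
    using g(2) by auto
  have contG: "continuous_on (ball 0 1) G"
    using G holomorphic_on_imp_continuous_on by blast
  have openg: "open (g ` ball 0 1)"
    using open_mapping_thm3[OF holomorphic_on_subset[OF g(1) sub(1)] open_ball]
      inj_on_subset[OF inj sub(1)] by blast
  \<comment> \<open>Restricting the exit set to a closed disk inside the unit disk makes it compact,
    so an exit point of least modulus exists.\<close>
  define A where "A = {z \<in> cball 0 (norm z1). G z \<notin> g ` ball 0 1}"
  have "closedin (top_of_set (cball 0 (norm z1))) (cball 0 (norm z1) \<inter> G -` (- g ` ball 0 1))"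
  proof (rule continuous_closedin_preimage)
    show "continuous_on (cball 0 (norm z1)) G"
      by (rule continuous_on_subset[OF contG]) (use z1 in auto)
  qed (use openg in \<open>simp add: closed_def\<close>)
  moreover have "cball 0 (norm z1) \<inter> G -` (- g ` ball 0 1) = A"
    by (auto simp: A_def)
  ultimately have "compact A"
    using closedin_compact compact_cball by metis
  moreover have "z1 \<in> A" using z1 by (auto simp: A_def)
  ultimately obtain z0 where z0A: "z0 \<in> A" and min: "\<And>z. z \<in> A \<Longrightarrow> norm z0 \<le> norm z"
    using continuous_attains_inf[of A norm] continuous_on_norm_id by blast
  define r where "r = norm z0"
  have r1: "r < 1" using z0A z1 by (auto simp: A_def r_def)
  have "0 \<notin> A" using G0 by (auto simp: A_def)
  then have r0: "r > 0" using z0A by (auto simp: r_def)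
  have inside: "G z \<in> g ` ball 0 1" if "norm z < r" for z
  proof (rule ccontr)
    assume "G z \<notin> g ` ball 0 1"
    then have "z \<in> A" using that z0A by (auto simp: A_def r_def)
    then show False using min[of z] that by (simp add: r_def)
  qed
  have closedg: "closed (g ` cball 0 1)"
    using compact_continuous_image[OF continuous_on_subset[OF holomorphic_on_imp_continuous_on[OF g(1)] sub(2)]]
    by (simp add: compact_imp_closed)
  have "G ` closure (ball 0 r) \<subseteq> closure (g ` ball 0 1)"
  proof (rule image_closure_subset)
    show "continuous_on (closure (ball 0 r)) G"
      by (rule continuous_on_subset[OF contG]) (use r1 r0 in auto)
    show "G ` ball 0 r \<subseteq> closure (g ` ball 0 1)"
      using inside closure_subset by fastforce
  qed simp
  moreover have "closure (g ` ball 0 1) \<subseteq> g ` cball 0 1"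
    by (rule closure_minimal[OF image_mono closedg]) auto
  moreover have "z0 \<in> closure (ball 0 r)" using r0 by (simp add: r_def)
  ultimately have "G z0 \<in> g ` cball 0 1" by blast
  then obtain \<zeta> where \<zeta>: "norm \<zeta> \<le> 1" "G z0 = g \<zeta>" by auto
  have "norm \<zeta> = 1"
    using z0A \<zeta> by (force simp: A_def)
  obtain h where h: "h holomorphic_on g ` ball 0 R"
    and inv: "\<And>z. z \<in> ball 0 R \<Longrightarrow> h (g z) = z"
    using holomorphic_has_inverse[OF g(1) open_ball inj] by metis
  have openR: "open (g ` ball 0 R)"
    by (rule open_mapping_thm3[OF g(1) open_ball inj])
  define S where "S = ball 0 1 \<inter> G -` (g ` ball 0 R)"
  have "open S"
    unfolding S_def by (rule continuous_open_preimage[OF contG open_ball openR])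
  have "z0 \<in> S" using \<zeta> r1 g(2) by (auto simp: S_def r_def)
  have ballS: "ball 0 r \<subseteq> S" using inside r1 sub by (force simp: S_def)
  define W where "W = h \<circ> G"
  have holW: "W holomorphic_on S"
    unfolding W_def
    by (rule holomorphic_on_compose_gen[OF holomorphic_on_subset[OF G] h]) (auto simp: S_def)
  have gW: "g (W z) = G z" if "z \<in> S" for z
    using that inv by (auto simp: S_def W_def)
  have Wz0: "W z0 = \<zeta>" using \<zeta> inv g(2) by (simp add: W_def)
  have derW: "(W has_field_derivative deriv W z0) (at z0)"
    using holomorphic_derivI[OF holW \<open>open S\<close> \<open>z0 \<in> S\<close>] .
  obtain m :: real where m: "m \<ge> 1" "z0 * deriv W z0 = of_real m * W z0"
  proof (rule jack_boundary_multiplier[of W r z0 "deriv W z0"])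
    show "W holomorphic_on ball 0 r" by (rule holomorphic_on_subset[OF holW ballS])
    show "W 0 = 0" using inv[of 0] g(2) by (simp add: W_def G0)
    show "norm (W z) < 1" if z: "norm z < r" for z
    proof -
      obtain u where "u \<in> ball 0 1" "G z = g u" using inside[OF z] by blast
      then show ?thesis using inv[of u] sub(1) by (auto simp: W_def)
    qed
  qed (use r0 derW Wz0 \<open>norm \<zeta> = 1\<close> in \<open>auto simp: r_def\<close>)
  have "(g has_field_derivative deriv g \<zeta>) (at \<zeta>)"
    using holomorphic_derivI[OF g(1) open_ball, of \<zeta>] \<zeta>(1) g(2) by auto
  then have "((\<lambda>z. g (W z)) has_field_derivative deriv g \<zeta> * deriv W z0) (at z0)"
    using DERIV_chain2[of g _ W z0, OF _ derW] Wz0 by simp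
  then have "(G has_field_derivative deriv g \<zeta> * deriv W z0) (at z0)"
    by (rule has_field_derivative_transform_within_open[OF _ \<open>open S\<close> \<open>z0 \<in> S\<close>]) (use gW in auto)
  then have "z0 * deriv G z0 = deriv g \<zeta> * (z0 * deriv W z0)"
    by (simp add: DERIV_imp_deriv)
  also have "\<dots> = of_real m * (\<zeta> * deriv g \<zeta>)" using m(2) Wz0 by simp
  finally show False
    using adm[of z0 \<zeta> m] r1 \<zeta>(2) \<open>norm \<zeta> = 1\<close> m(1) by (simp add: r_def)
qed

text \<open>In the logarithmic coordinate \<open>z = exp x\<close> the map \<open>h z = z - z^3 / 3\<close> becomes \<open>\<psi>\<close>, whose derivative
  \<open>z h' / h\<close> has positive real part. On the convex left half-plane this forces
  \<open>Re ((\<psi> x1 - \<psi> x2) / (x1 - x2)) > 0\<close>, which is incompatible with \<open>\<psi> x1 - \<psi> x2 = ln m\<close>.\<close>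

lemma cubic_starlike_exterior:
  fixes \<omega> \<zeta> :: complex
  assumes om: "norm \<omega> < 1" and ze: "norm \<zeta> = 1" and m: "m \<ge> 1"
  shows "\<omega> - \<omega> ^ 3 / 3 \<noteq> of_real m * (\<zeta> - \<zeta> ^ 3 / 3)"
proof
  assume eq: "\<omega> - \<omega> ^ 3 / 3 = of_real m * (\<zeta> - \<zeta> ^ 3 / 3)"
  have nz: "1 - u\<^sup>2 / 3 \<noteq> 0" if "norm u \<le> 1" for u :: complex
  proof
    assume "1 - u\<^sup>2 / 3 = 0"
    then have "norm (u\<^sup>2) = norm (3::complex)" by simp
    then have "(norm u)\<^sup>2 = 3" by (simp add: norm_power)
    then show False using that power_mono[of "norm u" 1 2] by simp
  qed
  have fac: "u - u ^ 3 / 3 = u * (1 - u\<^sup>2 / 3)" for u :: complex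
    by (simp add: power2_eq_square power3_eq_cube algebra_simps)
  have "\<zeta> \<noteq> 0" using ze by auto
  have "\<omega> \<noteq> 0"
  proof
    assume "\<omega> = 0"
    then show False using eq nz[of \<zeta>] ze m \<open>\<zeta> \<noteq> 0\<close> by (simp add: fac)
  qed
  define \<psi> where "\<psi> x = x + Ln (1 - exp (2 * x) / 3)" for x
  have expsq: "exp (2 * x) = (exp x)\<^sup>2" for x :: complex by (simp add: exp_double)
  have exp\<psi>: "exp (\<psi> x) = exp x - exp x ^ 3 / 3" if "Re x \<le> 0" for x
    using nz[of "exp x"] that by (simp add: \<psi>_def exp_add fac expsq exp_Ln)
  define x2 where "x2 = Ln \<zeta>"
  define y1 where "y1 = Ln \<omega>"
  have x2: "exp x2 = \<zeta>" "Re x2 = 0" using \<open>\<zeta> \<noteq> 0\<close> ze by (auto simp: x2_def)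
  have y1: "exp y1 = \<omega>" "Re y1 < 0" using \<open>\<omega> \<noteq> 0\<close> om by (auto simp: y1_def)
  have "exp (\<psi> y1) = exp (of_real (ln m) + \<psi> x2)"
    using exp\<psi>[of y1] exp\<psi>[of x2] x2 y1 eq m by (simp add: exp_add exp_of_real)
  then obtain n :: int where n: "\<psi> y1 = of_real (ln m) + \<psi> x2 + of_int (2 * n) * of_real pi * \<i>"
    unfolding exp_eq by auto
  \<comment> \<open>Equal exponentials agree only up to a multiple of 2 pi i. Moving this multiple
    into the point is harmless: the logarithm in \<open>\<psi>\<close> depends on
    \<open>exp (2 * x)\<close> alone, and the real part of the point is unchanged.\<close>
  define x1 where "x1 = y1 - of_int (2 * n) * of_real pi * \<i>"
  have e2: "exp (2 * x1) = exp (2 * y1)"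
    unfolding exp_eq by (rule exI[of _ "- 2 * n"]) (simp add: x1_def algebra_simps)
  have "\<psi> x1 = \<psi> y1 - of_int (2 * n) * of_real pi * \<i>"
    unfolding \<psi>_def e2 by (simp add: x1_def)
  then have \<psi>x1: "\<psi> x1 - \<psi> x2 = of_real (ln m)"
    using n by simp
  have x1: "Re x1 < 0" using y1 by (simp add: x1_def)
  define d where "d = x1 - x2"
  have "Re d < 0" using x1 x2 by (simp add: d_def)
  \<comment> \<open>Along the segment from \<open>x2\<close> to \<open>x1\<close> the derivative of
    \<open>F\<close> is |d|^2 times the real part of the derivative of \<open>\<psi>\<close>, hence
    positive; its total increment is \<open>ln m * Re d\<close>, which is at most 0.\<close>
  define F where "F t = \<psi> (x2 + of_real t * d) \<bullet> d" for t
  have "\<exists>y>0. (F has_real_derivative y) (at t)" if t: "0 < t" "t < 1" for t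
  proof -
    define x where "x = x2 + of_real t * d"
    define u where "u = exp (2 * x)"
    have "Re x < 0" using \<open>Re d < 0\<close> t x2 by (simp add: x_def mult_pos_neg)
    then have u1: "norm u < 1" by (simp add: u_def)
    have "Re (u / 3) < 1" using complex_Re_le_cmod[of u] u1 by simp
    then have rep: "Re (1 - u / 3) > 0" by simp
    have dpsi: "(\<psi> has_field_derivative 1 + (- (2 * u) / 3) / (1 - u / 3)) (at x)"
    proof -
      have "1 - u / 3 \<notin> \<real>\<^sub>\<le>\<^sub>0" using rep unfolding complex_nonpos_Reals_iff by linarith
      then show ?thesis
        unfolding \<psi>_def u_def by (auto intro!: derivative_eq_intros simp: divide_simps) (simp add: algebra_simps)
    qed
    have ne: "1 - u / 3 \<noteq> 0" using rep by auto
    have q: "1 + (- (2 * u) / 3) / (1 - u / 3) = (1 - u) / (1 - u / 3)"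
      using ne by (simp add: field_simps)
    have "Re ((1 - u) * cnj (1 - u / 3)) > 0"
    proof -
      have "Re ((1 - u) * cnj (1 - u / 3)) = 1 - 4 / 3 * Re u + (norm u)\<^sup>2 / 3"
        unfolding cmod_power2 by (simp add: field_simps power2_eq_square)
      \<comment> \<open>Replacing \<open>Re u\<close> by \<open>norm u\<close> in three times the
        real part leaves this factored quadratic.\<close>
      moreover have "0 < (1 - norm u) * (3 - norm u)" using u1 by simp
      then have "0 < 3 - 4 * norm u + (norm u)\<^sup>2"
        by (simp add: algebra_simps power2_eq_square)
      moreover have "Re u \<le> norm u" by (rule complex_Re_le_cmod)
      ultimately show ?thesis by linarith
    qed
    then have "Re ((1 - u) / (1 - u / 3)) > 0"
      using ne by (simp add: Re_complex_div_gt_0)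
    have lin: "((\<lambda>t. x2 + of_real t * d) has_vector_derivative d) (at t)"
      by (auto intro!: derivative_eq_intros simp: has_vector_derivative_def scaleR_conv_of_real)
    have "((\<lambda>t. \<psi> (x2 + of_real t * d)) has_vector_derivative d * ((1 - u) / (1 - u / 3))) (at t)"
      using field_vector_diff_chain_at[OF lin dpsi[unfolded q x_def]] by (simp only: o_def)
    then have "(F has_vector_derivative (d * ((1 - u) / (1 - u / 3))) \<bullet> d) (at t)"
      unfolding F_def by (rule bounded_linear.has_vector_derivative[OF bounded_linear_inner_left])
    moreover have "(d * ((1 - u) / (1 - u / 3))) \<bullet> d = (norm d)\<^sup>2 * Re ((1 - u) / (1 - u / 3))"
      unfolding cmod_power2 inner_complex_def times_complex.sel
      by (simp only: algebra_simps power2_eq_square)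
    moreover have "\<dots> > 0"
      using \<open>Re ((1 - u) / (1 - u / 3)) > 0\<close> \<open>Re d < 0\<close> by (intro mult_pos_pos) auto
    ultimately show ?thesis
      by (metis has_real_derivative_iff_has_vector_derivative)
  qed
  \<comment> \<open>The segment starts on the imaginary axis, where \<open>exp (2 * x)\<close> has
    modulus one and the derivative may vanish. Continuity suffices at this end, and the argument of
    \<open>Ln\<close> keeps a positive real part.\<close>
  moreover have "continuous_on {0..1} F"
  proof -
    have "continuous_on {0..1} (\<lambda>t. 1 - exp (2 * (x2 + of_real t * d)) / 3)"
      by (intro continuous_intros) auto
    have "1 - exp (2 * (x2 + of_real t * d)) / 3 \<notin> \<real>\<^sub>\<le>\<^sub>0" if "t \<in> {0..1}" for t
    proof -
      have "Re (x2 + of_real t * d) \<le> 0"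
        using that \<open>Re d < 0\<close> x2 by (simp add: mult_nonneg_nonpos)
      then have "norm (exp (2 * (x2 + of_real t * d))) \<le> 1" by simp
      then have "Re (exp (2 * (x2 + of_real t * d))) \<le> 1"
        using complex_Re_le_cmod order_trans by blast
      then have "Re (1 - exp (2 * (x2 + of_real t * d)) / 3) > 0" by simp
      then show ?thesis unfolding complex_nonpos_Reals_iff by linarith
    qed
    then show ?thesis unfolding F_def \<psi>_def by (intro continuous_intros) auto
  qed
  ultimately have "F 0 < F 1"
    using DERIV_pos_imp_increasing_open[of 0 1 F] by auto
  moreover have "F 1 - F 0 = ln m * Re d"
    using \<psi>x1 by (simp add: F_def d_def inner_diff_left[symmetric]) (simp add: inner_complex_def)
  moreover have "ln m * Re d \<le> 0"
    using m \<open>Re d < 0\<close> by (simp add: mult_nonneg_nonpos)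
  ultimately show False by simp
qed

section \<open>The logarithm of \<open>z f' / f\<close>\<close>

lemma holomorphic_primitive_ball:
  assumes "f holomorphic_on ball 0 r"
  obtains F where "F holomorphic_on ball 0 r" "F 0 = (0::complex)"
    "\<And>z. z \<in> ball 0 r \<Longrightarrow> (F has_field_derivative f z) (at z)"
proof -
  obtain g where g: "\<And>z. z \<in> ball 0 r \<Longrightarrow> (g has_field_derivative f z) (at z within ball 0 r)"
    using holomorphic_convex_primitive'[OF convex_ball open_ball assms] by auto
  have *: "((\<lambda>z. g z - g 0) has_field_derivative f z) (at z)" if "z \<in> ball 0 r" for z
    using g[OF that] that by (auto intro!: derivative_eq_intros simp: at_within_open[of z "ball 0 r"])
  show ?thesis
  proof (rule that[of "\<lambda>z. g z - g 0"])
    show "(\<lambda>z. g z - g 0) holomorphic_on ball 0 r"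
      unfolding holomorphic_on_open[OF open_ball] using * by blast
  qed (use * in auto)
qed

lemma remove_sings_eq_continuous_extension:
  assumes "eventually (\<lambda>w. f w = g w) (at z)" "isCont g z"
  shows "remove_sings f z = g z"
proof (rule remove_sings_eqI)
  show "(f \<longlongrightarrow> g z) (at z)"
    using assms(2) tendsto_cong[OF assms(1)] by (simp add: isCont_def)
qed

lemma class_A_nonzero_near:
  assumes "f \<in> class_A" "z \<in> ball 0 1"
  shows "eventually (\<lambda>w. f w \<noteq> 0 \<and> w \<in> ball 0 1) (at z)"
proof -
  have f: "f holomorphic_on ball 0 1" "f 0 = 0" "deriv f 0 = 1"
    using assms by (auto simp: class_A_def)
  have "\<exists>b\<in>ball 0 1. f b \<noteq> 0"
  proof (rule ccontr)
    assume "\<not> ?thesis"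
    then have "((\<lambda>_. 0) has_field_derivative deriv f 0) (at 0)"
      using holomorphic_derivI[OF f(1) open_ball, of 0]
      by (rule_tac has_field_derivative_transform_within_open[of f _ _ "ball 0 1"]) auto
    then have "deriv f 0 = 0" using DERIV_unique DERIV_const by blast
    then show False using f by simp
  qed
  then show ?thesis
    using non_zero_neighbour_alt[OF f(1) open_ball connected_ball assms(2)] by blast
qed

text \<open>The equation without division also covers the zeros of \<open>f\<close>. These are
  isolated, so the quotient agrees with the continuous \<open>p\<close> on a punctured neighbourhood
  of every point.\<close>

lemma remove_sings_log_derivative:
  assumes f: "f \<in> class_A" and p: "p holomorphic_on ball 0 1"
    and ode: "\<And>z. z \<in> ball 0 1 \<Longrightarrow> z * deriv f z = p z * f z" and z: "z \<in> ball 0 1"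
  shows "remove_sings (\<lambda>z. z * deriv f z / f z) z = p z"
proof (rule remove_sings_eq_continuous_extension)
  show "\<forall>\<^sub>F w in at z. w * deriv f w / f w = p w"
    using class_A_nonzero_near[OF f z] by eventually_elim (simp add: ode)
  show "isCont p z"
    using holomorphic_on_imp_continuous_on[OF p] z by (simp add: continuous_on_eq_continuous_at)
qed

text \<open>Writing \<open>p\<close> for the quotient \<open>z f' / f\<close>, the expression in the hypothesis is
  \<open>1 + \<beta> z p' / p\<close>.  Its analyticity at the origin determines \<open>p\<close> near \<open>0\<close> as an exponential, and the
  linear equation \<open>z f' = p f\<close> then continues to the disk, so zeros of \<open>f\<close> and \<open>f'\<close> need
  no separate discussion.\<close>

lemma class_A_exponential_form:
  assumes f: "f \<in> class_A" and "\<beta> \<noteq> 0"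
    and hol: "beta_expr \<beta> f holomorphic_on ball 0 1" and one: "beta_expr \<beta> f 0 = 1"
  obtains G where "G holomorphic_on ball 0 1" "G 0 = 0"
    "\<And>z. z \<in> ball 0 1 \<Longrightarrow> beta_expr \<beta> f z = 1 + of_real \<beta> * (z * deriv G z)"
    "\<And>z. z \<in> ball 0 1 \<Longrightarrow> remove_sings (\<lambda>z. z * deriv f z / f z) z = exp (G z)"
proof -
  have fA: "f holomorphic_on ball 0 1" "f 0 = 0" "deriv f 0 = 1"
    using f by (auto simp: class_A_def)
  have f': "deriv f holomorphic_on ball 0 1" by (rule holomorphic_deriv[OF fA(1) open_ball])
  have "(\<lambda>z. beta_expr \<beta> f z - 1) holomorphic_on ball 0 1" "beta_expr \<beta> f 0 - 1 = 0"
    using hol one by (auto intro: holomorphic_on_diff holomorphic_on_const)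
  \<comment> \<open>Dividing out the zero at the origin makes \<open>R / \<beta>\<close>
    holomorphic; its primitive \<open>G\<close> is the candidate for the logarithm of z f' /
    f.\<close>
  from Schwarz3[OF this] obtain R where R: "R holomorphic_on ball 0 1"
    "\<And>z. norm z < 1 \<Longrightarrow> beta_expr \<beta> f z - 1 = z * R z"
    by metis
  have "(\<lambda>z. R z / of_real \<beta>) holomorphic_on ball 0 1"
    using R(1) \<open>\<beta> \<noteq> 0\<close> by (intro holomorphic_intros) auto
  then obtain G where G: "G holomorphic_on ball 0 1" "G 0 = 0"
    "\<And>z. z \<in> ball 0 1 \<Longrightarrow> (G has_field_derivative R z / of_real \<beta>) (at z)"
    using holomorphic_primitive_ball by blast
  have bG: "beta_expr \<beta> f z = 1 + of_real \<beta> * (z * deriv G z)" if "z \<in> ball 0 1" for z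
    using R(2)[of z] DERIV_imp_deriv[OF G(3)[OF that]] that \<open>\<beta> \<noteq> 0\<close> by (simp add: field_simps)
  obtain g where g: "g holomorphic_on ball 0 1" "\<And>z. norm z < 1 \<Longrightarrow> f z = z * g z" "g 0 = 1"
    using Schwarz3[OF fA(1,2)] fA(3) by metis
  have "eventually (\<lambda>z. g z \<noteq> 0 \<and> deriv f z \<noteq> 0 \<and> z \<in> ball 0 1) (nhds 0)"
  proof (intro eventually_conj)
    have "isCont g 0" "isCont (deriv f) 0"
      using g(1) f' by (auto simp: holomorphic_on_imp_continuous_on continuous_on_eq_continuous_at
          dest!: holomorphic_on_imp_continuous_on)
    then show "eventually (\<lambda>z. g z \<noteq> 0) (nhds 0)" "eventually (\<lambda>z. deriv f z \<noteq> 0) (nhds 0)"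
      using tendsto_imp_eventually_ne[of g 1 "nhds 0" 0] tendsto_imp_eventually_ne[of "deriv f" 1 "nhds 0" 0] g(3) fA(3)
      by (auto simp: continuous_at_imp_continuous_at_within isCont_def tendsto_nhds_iff)
    show "eventually (\<lambda>z::complex. z \<in> ball 0 1) (nhds 0)"
      by (rule eventually_nhds_in_open) auto
  qed
  then obtain r where r: "r > 0"
    "\<And>z. z \<in> ball 0 r \<Longrightarrow> g z \<noteq> 0 \<and> deriv f z \<noteq> 0 \<and> z \<in> ball 0 1"
    unfolding eventually_nhds_metric by (auto simp: dist_commute)
  have rsub: "ball 0 r \<subseteq> ball (0::complex) 1" using r by blast
  \<comment> \<open>With f = z g, the constancy \<open>u = 1\<close> is the desired equation z f' =
    exp(G) f, freed of the zero at the origin.\<close>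
  define u where "u z = deriv f z / g z * exp (- G z)" for z
  have "u constant_on ball 0 r"
  \<comment> \<open>The origin is exempted because \<open>f\<close> vanishes there and the raw
    quotient is meaningless; continuity of \<open>u\<close> covers this point.\<close>
  proof (rule DERIV_zero_connected_constant_on[of _ "{0}"])
    have "u holomorphic_on ball 0 r"
      unfolding u_def using r
      by (intro holomorphic_on_mult holomorphic_on_divide holomorphic_on_exp' holomorphic_on_minus
          holomorphic_on_subset[OF f' rsub] holomorphic_on_subset[OF g(1) rsub]
          holomorphic_on_subset[OF G(1) rsub]) auto
    then show "continuous_on (ball 0 r) u" by (rule holomorphic_on_imp_continuous_on)
    show "\<forall>z\<in>ball 0 r - {0}. (u has_field_derivative 0) (at z)"
    proof
      fix z :: complex assume z: "z \<in> ball 0 r - {0}"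
      then have z1: "z \<in> ball 0 1" and nz: "z \<noteq> 0" "g z \<noteq> 0" "deriv f z \<noteq> 0" using r by auto
      have fz: "f z = z * g z" using g(2) z1 by simp
      have d1: "(f has_field_derivative deriv f z) (at z)"
        by (rule holomorphic_derivI[OF fA(1) open_ball z1])
      have d2: "(deriv f has_field_derivative deriv (deriv f) z) (at z)"
        by (rule holomorphic_derivI[OF f' open_ball z1])
      have d3: "(g has_field_derivative deriv g z) (at z)"
        by (rule holomorphic_derivI[OF g(1) open_ball z1])
      have "((\<lambda>z. z * g z) has_field_derivative deriv f z) (at z)"
        by (rule has_field_derivative_transform_within_open[OF d1 open_ball z1]) (use g(2) in auto)
      moreover have "((\<lambda>z. z * g z) has_field_derivative g z + z * deriv g z) (at z)"
        by (rule derivative_eq_intros refl d3 | simp)+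
      ultimately have f'z: "deriv f z = g z + z * deriv g z"
        by (rule DERIV_unique)
      \<comment> \<open>Away from the zeros of \<open>f\<close> and \<open>deriv f\<close> the
        unregularised expression is analytic, so \<open>remove_sings\<close> leaves its value
        unchanged.\<close>
      define E where "E = (\<lambda>z. 1 + of_real \<beta> * (1 - z * deriv f z / f z + z * deriv (deriv f) z / deriv f z))"
      have "E holomorphic_on ball 0 r - {0}"
        unfolding E_def using r rsub g(2) fA(1) f' holomorphic_deriv[OF f' open_ball]
        by (intro holomorphic_intros) (auto intro: holomorphic_on_subset)
      then have "E analytic_on {z}"
        using z by (auto simp: analytic_at intro!: exI[of _ "ball 0 r - {0}"])
      then have "beta_expr \<beta> f z = E z"
        unfolding beta_expr_def E_def by (rule remove_sings_at_analytic)
      then have "of_real \<beta> * (z * deriv G z)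
            = of_real \<beta> * (1 - z * deriv f z / f z + z * deriv (deriv f) z / deriv f z)"
        using bG[OF z1] by (simp add: E_def)
      then have "z * deriv G z = 1 - z * deriv f z / f z + z * deriv (deriv f) z / deriv f z"
        using \<open>\<beta> \<noteq> 0\<close> by simp
      then have "z * deriv G z = z * (deriv (deriv f) z / deriv f z - deriv g z / g z)"
        using nz by (simp add: fz) (simp add: f'z field_simps)
      then have G'z: "deriv G z = deriv (deriv f) z / deriv f z - deriv g z / g z"
        using nz by simp
      have d4: "(G has_field_derivative deriv G z) (at z)"
        by (rule holomorphic_derivI[OF G(1) open_ball z1])
      have "(u has_field_derivative
          ((deriv (deriv f) z * g z - deriv f z * deriv g z) / (g z * g z)) * exp (- G z)
            + (exp (- G z) * (- deriv G z)) * (deriv f z / g z)) (at z)"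
        unfolding u_def
        by (rule derivative_eq_intros refl d2 d3 d4 nz | simp)+
      moreover have "((deriv (deriv f) z * g z - deriv f z * deriv g z) / (g z * g z)) * exp (- G z)
            + (exp (- G z) * (- deriv G z)) * (deriv f z / g z) = 0"
        unfolding G'z using nz by (simp add: field_simps)
      ultimately show "(u has_field_derivative 0) (at z)" by simp
    qed
  qed auto
  moreover have "u 0 = 1" by (simp add: u_def fA g G)
  ultimately have u1: "u z = 1" if "z \<in> ball 0 r" for z
    using r that unfolding constant_on_def by (metis centre_in_ball)
  have near: "z * deriv f z = exp (G z) * f z" if "z \<in> ball 0 r" for z
    using u1[OF that] r(2)[OF that] g(2)[of z] by (simp add: u_def exp_minus field_simps)
  have ode: "z * deriv f z = exp (G z) * f z" if "z \<in> ball 0 1" for z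
  proof (rule analytic_continuation_open[of "ball 0 r" "ball 0 1" "\<lambda>z. z * deriv f z" "\<lambda>z. exp (G z) * f z"])
    show "(\<lambda>z. z * deriv f z) holomorphic_on ball 0 1"
      by (intro holomorphic_on_mult holomorphic_on_ident f')
    show "(\<lambda>z. exp (G z) * f z) holomorphic_on ball 0 1"
      using G(1) fA(1) by (intro holomorphic_intros)
  qed (use r rsub near that in auto)
  have eG: "(\<lambda>z. exp (G z)) holomorphic_on ball 0 1" using G(1) by (intro holomorphic_intros)
  show ?thesis
    by (rule that[OF G(1,2) bG remove_sings_log_derivative[OF f eG ode]])
qed

text \<open>Converse construction, for the extremal functions: f = z exp(K) with K' = (exp(G) - 1) /
  z solves z f' / f = exp(G), and then f' = exp(K + G) has no zeros.\<close>

lemma class_A_from_exponent: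
  assumes G: "G holomorphic_on ball 0 1" "G 0 = 0"
  obtains f where "f \<in> class_A"
    "\<And>\<beta> z. z \<in> ball 0 1 \<Longrightarrow> beta_expr \<beta> f z = 1 + of_real \<beta> * (z * deriv G z)"
    "\<And>z. z \<in> ball 0 1 \<Longrightarrow> remove_sings (\<lambda>z. z * deriv f z / f z) z = exp (G z)"
proof -
  have eG: "(\<lambda>z. exp (G z)) holomorphic_on ball 0 1" using G(1) by (intro holomorphic_intros)
  have "(\<lambda>z. exp (G z) - 1) holomorphic_on ball 0 1" "exp (G 0) - 1 = 0"
    using eG G(2) by (auto intro: holomorphic_on_diff holomorphic_on_const)
  from Schwarz3[OF this] obtain q where q: "q holomorphic_on ball 0 1"
    "\<And>z. norm z < 1 \<Longrightarrow> exp (G z) - 1 = z * q z"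
    by metis
  obtain K where K: "K holomorphic_on ball 0 1" "K 0 = 0"
    "\<And>z. z \<in> ball 0 1 \<Longrightarrow> (K has_field_derivative q z) (at z)"
    using holomorphic_primitive_ball[OF q(1)] by auto
  define f where "f z = z * exp (K z)" for z
  have holf: "f holomorphic_on ball 0 1" unfolding f_def using K(1) by (intro holomorphic_intros)
  have f': "deriv f z = exp (K z + G z)" if "z \<in> ball 0 1" for z
  proof -
    have "(f has_field_derivative exp (K z) + z * (exp (K z) * q z)) (at z)"
      unfolding f_def by (rule derivative_eq_intros refl K(3)[OF that] | simp)+
    moreover have "exp (K z) + z * (exp (K z) * q z) = exp (K z) * (1 + z * q z)"
      by (simp add: algebra_simps)
    moreover have "1 + z * q z = exp (G z)" using q(2)[of z] that by (simp add: algebra_simps)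
    ultimately show ?thesis by (simp add: DERIV_imp_deriv exp_add)
  qed
  have f'': "deriv (deriv f) z = exp (K z + G z) * (q z + deriv G z)" if "z \<in> ball 0 1" for z
  proof (rule DERIV_imp_deriv)
    have "((\<lambda>z. exp (K z + G z)) has_field_derivative exp (K z + G z) * (q z + deriv G z)) (at z)"
      by (rule derivative_eq_intros refl K(3)[OF that] holomorphic_derivI[OF G(1) open_ball that] | simp)+
    then show "(deriv f has_field_derivative exp (K z + G z) * (q z + deriv G z)) (at z)"
      by (rule has_field_derivative_transform_within_open[OF _ open_ball that]) (use f' in auto)
  qed
  have fA: "f \<in> class_A"
    using holf f'[of 0] by (simp add: class_A_def G K) (simp add: f_def)
  have ode: "z * deriv f z = exp (G z) * f z" if "z \<in> ball 0 1" for z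
    using f'[OF that] by (simp add: f_def exp_add)
  have "beta_expr \<beta> f z = 1 + of_real \<beta> * (z * deriv G z)" if z: "z \<in> ball 0 1" for \<beta> z
    unfolding beta_expr_def
  proof (rule remove_sings_eq_continuous_extension)
    show "\<forall>\<^sub>F w in at z. 1 + of_real \<beta> * (1 - w * deriv f w / f w + w * deriv (deriv f) w / deriv f w)
        = 1 + of_real \<beta> * (w * deriv G w)"
      using class_A_nonzero_near[OF fA z]
    proof eventually_elim
      case (elim w)
      then have "w * deriv f w / f w = 1 + w * q w"
        using ode[of w] q(2)[of w] by (simp add: field_simps)
      moreover have "w * deriv (deriv f) w / deriv f w = w * (q w + deriv G w)"
        using elim f'[of w] f''[of w] by simp
      ultimately show ?case by (simp only:) (simp add: algebra_simps)
    qed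
    have "(\<lambda>z. 1 + of_real \<beta> * (z * deriv G z)) holomorphic_on ball 0 1"
      by (intro holomorphic_on_add holomorphic_on_mult holomorphic_on_const holomorphic_on_ident
          holomorphic_deriv[OF G(1) open_ball])
    then show "isCont (\<lambda>z. 1 + of_real \<beta> * (z * deriv G z)) z"
      using z by (auto dest!: holomorphic_on_imp_continuous_on simp: continuous_on_eq_continuous_at)
  qed
  then show ?thesis
    by (rule that[OF fA _ remove_sings_log_derivative[OF fA eG ode]])
qed

section \<open>The region \<open>exp (\<mu> Q (D))\<close> and the three targets\<close>

text \<open>For positive real part a, the real part of Q grows with b^2, so b^2 may be raised to 1 -
  a^2. What remains, 4/9 (3 a - a^3) < 8/9, is the positivity of (1 - a)^2 (2 + a). Oddness of Q
  gives the lower bound.\<close>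

lemma Re_cubic:
  fixes v :: complex assumes v: "norm v < 1"
  shows "\<bar>Re (v - v ^ 3 / 9)\<bar> < 8 / 9"
proof -
  have pos: "a - (a ^ 3 - 3 * a * b\<^sup>2) / 9 < 8 / 9" if "a\<^sup>2 + b\<^sup>2 < 1" for a b :: real
  proof (cases "a \<le> 0")
    case True
    have "a\<^sup>2 < 1" using that zero_le_power2[of b] by linarith
    then have "a * (1 - a\<^sup>2 / 9 + b\<^sup>2 / 3) \<le> 0"
      using True by (intro mult_nonpos_nonneg) auto
    then show ?thesis by (simp add: field_simps power2_eq_square power3_eq_cube)
  next
    case False
    have "a\<^sup>2 < 1" using that zero_le_power2[of b] by linarith
    then have a1: "a < 1" using power2_less_imp_less[of a 1] by simp
    have "a * b\<^sup>2 \<le> a * (1 - a\<^sup>2)" using False that by (intro mult_left_mono) auto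
    then have "a * b\<^sup>2 \<le> a - a ^ 3" by (simp add: algebra_simps power2_eq_square power3_eq_cube)
    moreover have "(1 - a)\<^sup>2 * (2 + a) > 0" using a1 False by simp
    then have "2 - 3 * a + a ^ 3 > 0" by (simp add: algebra_simps power2_eq_square power3_eq_cube)
    moreover have "a - (a ^ 3 - 3 * a * b\<^sup>2) / 9 = a - a ^ 3 / 9 + a * b\<^sup>2 / 3"
      by (simp add: field_simps)
    ultimately show ?thesis by linarith
  qed
  have n: "(Re v)\<^sup>2 + (Im v)\<^sup>2 < 1"
    using v power_strict_mono[of "norm v" 1 2] by (simp add: cmod_power2)
  have odd: "- a - ((- a) ^ 3 - 3 * (- a) * b\<^sup>2) / 9 = - (a - (a ^ 3 - 3 * a * b\<^sup>2) / 9)" for a b :: real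
    by (simp add: field_simps)
  have neg: "- (Re v - (Re v ^ 3 - 3 * Re v * (Im v)\<^sup>2) / 9) < 8 / 9"
    using pos[of "- Re v" "Im v"] n unfolding odd by simp
  have "Re (v - v ^ 3 / 9) = Re v - (Re v ^ 3 - 3 * Re v * (Im v)\<^sup>2) / 9"
    by (simp add: power2_eq_square power3_eq_cube algebra_simps)
  then show ?thesis
    unfolding abs_less_iff using pos[OF n] neg by (simp only:)
qed

lemma Im_cubic:
  fixes v :: complex assumes v: "norm v < 1"
  shows "\<bar>Im (v - v ^ 3 / 9)\<bar> < 10 / 9"
proof -
  have "\<bar>Im (v - v ^ 3 / 9)\<bar> \<le> norm (v - v ^ 3 / 9)" by (rule abs_Im_le_cmod)
  also have "\<dots> \<le> norm v + norm v ^ 3 / 9"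
    using norm_triangle_ineq4[of v "v ^ 3 / 9"] by (simp add: norm_divide norm_power)
  also have "\<dots> < 10 / 9"
    using v power_le_one[of "norm v" 3] by simp
  finally show ?thesis .
qed

lemma Re_Im_cubic:
  fixes v :: complex assumes v: "norm v < 1"
  shows "2 * Re (v - v ^ 3 / 9) + \<bar>Im (v - v ^ 3 / 9)\<bar> \<le> 221 / 100"
proof (cases "Re v \<le> 0")
  case True
  have n: "(Re v)\<^sup>2 + (Im v)\<^sup>2 < 1"
    using v power_strict_mono[of "norm v" 1 2] by (simp add: cmod_power2)
  have "(Re v)\<^sup>2 < 1" using n zero_le_power2[of "Im v"] by linarith
  then have "Re v * (1 - (Re v)\<^sup>2 / 9 + (Im v)\<^sup>2 / 3) \<le> 0"
    using True by (intro mult_nonpos_nonneg) auto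
  moreover have "Re (v - v ^ 3 / 9) = Re v * (1 - (Re v)\<^sup>2 / 9 + (Im v)\<^sup>2 / 3)"
    by (simp add: power2_eq_square power3_eq_cube field_simps)
  ultimately show ?thesis using Im_cubic[OF v] by linarith
next
  case False
  define a B where "a = Re v" and "B = \<bar>Im v\<bar>"
  have a: "a > 0" and B: "B \<ge> 0" using False by (auto simp: a_def B_def)
  have n: "a\<^sup>2 + B\<^sup>2 < 1"
    using v power_strict_mono[of "norm v" 1 2] by (simp add: cmod_power2 a_def B_def)
  then have a2: "a\<^sup>2 < 1" using zero_le_power2[of B] by linarith
  then have a1: "a < 1" using power2_less_imp_less[of a 1] by simp
  have "Re (v - v ^ 3 / 9) = a * (1 - a\<^sup>2 / 9 + B\<^sup>2 / 3)"
    by (simp add: power2_eq_square power3_eq_cube field_simps a_def B_def)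
  also have "\<dots> \<le> a * (4 / 3 - 4 / 9 * a\<^sup>2)"
    using a n by (intro mult_left_mono) auto
  finally have re: "Re (v - v ^ 3 / 9) \<le> a * (4 / 3 - 4 / 9 * a\<^sup>2)" .
  have "Im (v - v ^ 3 / 9) = Im v * (1 - a\<^sup>2 / 3 + B\<^sup>2 / 9)"
    by (simp add: power2_eq_square power3_eq_cube field_simps a_def B_def)
  then have "\<bar>Im (v - v ^ 3 / 9)\<bar> = B * (1 - a\<^sup>2 / 3 + B\<^sup>2 / 9)"
    using a2 by (simp add: abs_mult B_def)
  also have "\<dots> \<le> B * (10 / 9 - 4 / 9 * a\<^sup>2)"
    using B n by (intro mult_left_mono) auto
  \<comment> \<open>Linearising at 7/10, close to the imaginary part at the extremal point, replaces
    \<open>B\<close> by a polynomial in \<open>a\<close>.\<close>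
  also have "B \<le> (149 / 100 - a\<^sup>2) / (14 / 10)"
  proof -
    have "0 \<le> (B - 7 / 10)\<^sup>2" by simp
    then show ?thesis using n by (simp add: power2_eq_square field_simps)
  qed
  then have "B * (10 / 9 - 4 / 9 * a\<^sup>2) \<le> (149 / 100 - a\<^sup>2) / (14 / 10) * (10 / 9 - 4 / 9 * a\<^sup>2)"
    using a2 by (intro mult_right_mono) auto
  finally have im: "\<bar>Im (v - v ^ 3 / 9)\<bar> \<le> (149 / 100 - a\<^sup>2) / (14 / 10) * (10 / 9 - 4 / 9 * a\<^sup>2)" .
  \<comment> \<open>The quartic bound left over is nearly tight at \<open>a = 141/200\<close>; subtracting the square there
    leaves a linear remainder.\<close>
  have "a * a \<le> 1" using a2 by (simp add: power2_eq_square)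
  then have "0 \<le> (a - 141 / 200)\<^sup>2 * (257877 / 10000 + 139 / 25 * a - 4 * (a * a))"
    using a by (intro mult_nonneg_nonneg) auto
  then show ?thesis
    using re im a a1 by (simp add: power2_eq_square field_simps)
qed

text \<open>Everything that the separation arguments need about the region: modulus, two forms of
  argument control, and the support line of \<open>Re_Im_cubic\<close>. The last is carried over
  through |w|^2 exp|B| = exp(2 A + |B|) and a Taylor polynomial, so that only |w| and
  \<open>Im w\<close> occur.\<close>

lemma exp_cubic_bounds:
  fixes v w :: complex
  assumes v: "norm v < 1" and \<mu>: "\<mu> > 0" and w: "w = exp (of_real \<mu> * (v - v ^ 3 / 9))"
  shows "exp (- (8 / 9 * \<mu>)) < norm w" "norm w < exp (8 / 9 * \<mu>)"
    "10 / 9 * \<mu> \<le> pi / 4 \<Longrightarrow> \<bar>Im w\<bar> < Re w"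
    "10 / 9 * \<mu> \<le> \<delta> \<Longrightarrow> \<bar>Im w\<bar> \<le> \<delta> * norm w"
    "(norm w)\<^sup>2 + norm w * \<bar>Im w\<bar> + (Im w)\<^sup>2 / 2 \<le> exp (221 / 100 * \<mu>)"
proof -
  define A B where "A = \<mu> * Re (v - v ^ 3 / 9)" and "B = \<mu> * Im (v - v ^ 3 / 9)"
  have nw: "norm w = exp A" by (simp add: w A_def)
  have Re: "Re w = norm w * cos B" and Im: "Im w = norm w * sin B"
    unfolding w by (simp_all add: Re_exp Im_exp B_def)
  have "\<bar>A\<bar> < \<mu> * (8 / 9)"
    using Re_cubic[OF v] \<mu> by (simp only: A_def abs_mult abs_of_pos mult_less_cancel_left_pos)
  then show "exp (- (8 / 9 * \<mu>)) < norm w" "norm w < exp (8 / 9 * \<mu>)"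
    by (auto simp: nw abs_less_iff)
  have absB: "\<bar>B\<bar> < \<mu> * (10 / 9)"
    using Im_cubic[OF v] \<mu> by (simp only: B_def abs_mult abs_of_pos mult_less_cancel_left_pos)
  show "\<bar>Im w\<bar> < Re w" if "10 / 9 * \<mu> \<le> pi / 4"
  proof -
    have lt: "\<bar>B\<bar> < pi / 4" using absB that by linarith
    have "sin \<bar>B\<bar> < sin (pi / 4)" using lt by (intro sin_monotone_2pi) auto
    also have "sin (pi / 4) = cos (pi / 4)" by (simp add: sin_45 cos_45)
    also have "\<dots> < cos \<bar>B\<bar>" using lt by (intro cos_monotone_0_pi) auto
    finally have "sin \<bar>B\<bar> < cos B" by simp
    moreover have "sin \<bar>B\<bar> \<ge> 0" using lt by (intro sin_ge_zero) auto
    ultimately have "\<bar>sin B\<bar> < cos B" by (cases "B \<ge> 0") auto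
    then show ?thesis
      by (simp add: Re Im abs_mult nw)
  qed
  have sB: "\<bar>sin B\<bar> \<le> \<bar>B\<bar>" by (rule abs_sin_x_le_abs_x)
  show "\<bar>Im w\<bar> \<le> \<delta> * norm w" if "10 / 9 * \<mu> \<le> \<delta>"
  proof -
    have "\<bar>sin B\<bar> \<le> \<delta>" using sB absB that by linarith
    then show ?thesis by (simp add: Im abs_mult mult.commute nw)
  qed
  have "2 * A + \<bar>B\<bar> = \<mu> * (2 * Re (v - v ^ 3 / 9) + \<bar>Im (v - v ^ 3 / 9)\<bar>)"
    using \<mu> by (simp only: A_def B_def abs_mult abs_of_pos distrib_left mult.left_commute)
  also have "\<dots> \<le> \<mu> * (221 / 100)"
    using Re_Im_cubic[OF v] \<mu> by (intro mult_left_mono) auto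
  finally have AB: "2 * A + \<bar>B\<bar> \<le> 221 / 100 * \<mu>" by simp
  have "(norm w)\<^sup>2 + norm w * \<bar>Im w\<bar> + (Im w)\<^sup>2 / 2 = (norm w)\<^sup>2 * (1 + \<bar>sin B\<bar> + \<bar>sin B\<bar>\<^sup>2 / 2)"
    by (simp add: Im abs_mult power_mult_distrib algebra_simps power2_eq_square)
  also have "\<dots> \<le> (norm w)\<^sup>2 * (1 + \<bar>B\<bar> + \<bar>B\<bar>\<^sup>2 / 2)"
    using sB power_mono[OF sB, of 2] by (intro mult_left_mono) auto
  also have "\<dots> \<le> (norm w)\<^sup>2 * exp \<bar>B\<bar>"
    using exp_lower_Taylor_quadratic[of "\<bar>B\<bar>"] by (intro mult_left_mono) auto
  also have "\<dots> = exp (2 * A + \<bar>B\<bar>)"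
    by (simp add: nw exp_add exp_double)
  also have "\<dots> \<le> exp (221 / 100 * \<mu>)" using AB by simp
  finally show "(norm w)\<^sup>2 + norm w * \<bar>Im w\<bar> + (Im w)\<^sup>2 / 2 \<le> exp (221 / 100 * \<mu>)" .
qed

lemma norm_1_components:
  fixes \<zeta> :: complex
  assumes "norm \<zeta> = 1"
  shows "(Re \<zeta>)\<^sup>2 + (Im \<zeta>)\<^sup>2 = 1" "\<bar>Re \<zeta>\<bar> \<le> 1" "\<bar>Im \<zeta>\<bar> \<le> 1"
  using assms cmod_power2[of \<zeta>] abs_Re_le_cmod[of \<zeta>] abs_Im_le_cmod[of \<zeta>] by auto

section \<open>Separating the region from the images of the unit circle\<close>

lemma exp_cubic_avoids_phi_Ne:
  fixes v \<zeta> :: complex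
  assumes v: "norm v < 1" and ze: "norm \<zeta> = 1" and \<mu>: "\<mu> > 0" "exp (8 / 9 * \<mu>) = 5 / 3"
  shows "exp (of_real \<mu> * (v - v ^ 3 / 9)) \<noteq> phi_Ne \<zeta>"
proof
  assume eq: "exp (of_real \<mu> * (v - v ^ 3 / 9)) = phi_Ne \<zeta>"
  define c s where "c = Re \<zeta>" and "s = Im \<zeta>"
  have cs: "c\<^sup>2 + s\<^sup>2 = 1" and c1: "\<bar>c\<bar> \<le> 1" and s1: "\<bar>s\<bar> \<le> 1"
    using norm_1_components[OF ze] by (auto simp: c_def s_def)
  have s2: "s\<^sup>2 = 1 - c\<^sup>2" using cs by simp
  have X: "Re (phi_Ne \<zeta>) = 1 + 2 * c - 4 / 3 * c ^ 3"
  proof -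
    have "Re (phi_Ne \<zeta>) = 1 + c - (c ^ 3 - 3 * c * s\<^sup>2) / 3"
      by (simp add: phi_Ne_def c_def s_def power2_eq_square power3_eq_cube algebra_simps)
    then show ?thesis unfolding s2 by (simp add: power2_eq_square power3_eq_cube field_simps)
  qed
  have Y: "Im (phi_Ne \<zeta>) = 4 / 3 * s ^ 3"
  proof -
    have "Im (phi_Ne \<zeta>) = s - (3 * c\<^sup>2 * s - s ^ 3) / 3"
      by (simp add: phi_Ne_def c_def s_def power2_eq_square power3_eq_cube algebra_simps)
    also have "c\<^sup>2 = 1 - s\<^sup>2" using cs by simp
    finally show ?thesis by (simp add: power2_eq_square power3_eq_cube field_simps)
  qed
  have "(s ^ 3)\<^sup>2 = (s\<^sup>2) ^ 3" by (simp flip: power_mult)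
  then have N: "(norm (phi_Ne \<zeta>))\<^sup>2 = (1 + 2 * c - 4 / 3 * c ^ 3)\<^sup>2 + 16 / 9 * (1 - c\<^sup>2) ^ 3"
    unfolding cmod_power2 X Y s2[symmetric] by (simp add: power_mult_distrib power2_eq_square)
  also have "\<dots> = 25 / 9 + 4 * c - 4 / 3 * c\<^sup>2 - 8 / 3 * c ^ 3"
    by (simp add: power2_eq_square power3_eq_cube field_simps)
  finally have N: "(norm (phi_Ne \<zeta>))\<^sup>2 = 25 / 9 + 4 * c - 4 / 3 * c\<^sup>2 - 8 / 3 * c ^ 3" .
  \<comment> \<open>This bounds 10/9 \<mu> by 3/4, which is below pi/4.\<close>
  have "exp (3 / 5) > (5 / 3 :: real)"
    using exp_lower_Taylor_quadratic[of "3 / 5 :: real"] by (simp add: power2_eq_square)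
  then have "exp (8 / 9 * \<mu>) < exp (3 / 5)" unfolding \<mu>(2) .
  then have "8 / 9 * \<mu> < 3 / 5" by (simp only: exp_less_cancel_iff)
  then have "10 / 9 * \<mu> \<le> pi / 4" using pi_approx(1) by simp
  note b = exp_cubic_bounds[OF v \<mu>(1) eq[symmetric]]
  have b1: "norm (phi_Ne \<zeta>) > 3 / 5" using b(1) \<mu>(2) by (simp only: exp_minus) simp
  have b2: "norm (phi_Ne \<zeta>) < 5 / 3" using b(2) \<mu>(2) by simp
  have b3: "\<bar>Im (phi_Ne \<zeta>)\<bar> < Re (phi_Ne \<zeta>)" by (rule b(3)) fact
  \<comment> \<open>In the first range the modulus is at least 5/3, in the second at most 3/5; in
    the third |Im| >= Re, against the argument bound.\<close>
  consider "c \<ge> 0" | "c \<le> - (7 / 10)" | "- (7 / 10) \<le> c" "c \<le> 0" by linarith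
  then show False
  proof cases
    case 1
    have "0 \<le> c * ((1 - c) * (3 + 2 * c))" using 1 c1 by simp
    then have "(norm (phi_Ne \<zeta>))\<^sup>2 \<ge> (5 / 3)\<^sup>2"
      unfolding N by (simp add: power2_eq_square power3_eq_cube algebra_simps)
    moreover have "(norm (phi_Ne \<zeta>))\<^sup>2 < (5 / 3)\<^sup>2"
      by (rule power_strict_mono[OF b2]) auto
    ultimately show False by linarith
  next
    case 2
    define a where "a = - c"
    have a: "7 / 10 \<le> a" "a \<le> 1" using 2 c1 by (auto simp: a_def)
    \<comment> \<open>The cube is bounded by its chord over [7/10, 1] and the square by its tangent
      at the midpoint, which leaves a linear inequality.\<close>
    have "0 \<le> (a - 7 / 10) * ((1 - a) * (a + 17 / 10))" using a by simp
    then have a3: "a ^ 3 \<le> 219 / 100 * a - 119 / 100"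
      by (simp add: power3_eq_cube field_simps)
    have "0 \<le> (a - 85 / 100)\<^sup>2" by simp
    then have a2: "a\<^sup>2 \<ge> 17 / 10 * a - 7225 / 10000"
      by (simp add: power2_eq_square field_simps)
    have "(norm (phi_Ne \<zeta>))\<^sup>2 = 25 / 9 - 4 * a - 4 / 3 * a\<^sup>2 + 8 / 3 * a ^ 3"
      unfolding N by (simp add: a_def)
    also have "\<dots> \<le> 9 / 25" using a2 a3 a by linarith
    also have "9 / 25 = (3 / 5 :: real)\<^sup>2" by (simp add: power2_eq_square)
    finally have "(norm (phi_Ne \<zeta>))\<^sup>2 \<le> (3 / 5)\<^sup>2" .
    moreover have "(3 / 5)\<^sup>2 < (norm (phi_Ne \<zeta>))\<^sup>2"
      by (rule power_strict_mono[OF b1]) auto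
    ultimately show False by linarith
  next
    case 3
    define a where "a = - c"
    have a: "0 \<le> a" "a \<le> 7 / 10" using 3 by (auto simp: a_def)
    \<comment> \<open>Passing to the fourth power gives a lower bound that is polynomial in
      \<open>a\<close>.\<close>
    have "\<bar>s\<bar> ^ 4 \<le> \<bar>s\<bar> ^ 3" by (rule power_decreasing) (use s1 in auto)
    moreover have "\<bar>s\<bar> ^ 4 = (1 - a\<^sup>2)\<^sup>2"
      unfolding a_def power2_minus s2[symmetric] by simp
    ultimately have "\<bar>Im (phi_Ne \<zeta>)\<bar> \<ge> 4 / 3 * (1 - a\<^sup>2)\<^sup>2"
      unfolding Y by (simp add: abs_mult power_abs)
    moreover have "Re (phi_Ne \<zeta>) = 1 - 2 * a + 4 / 3 * a ^ 3"
      unfolding X a_def by simp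
    moreover have "1 - 2 * a + 4 / 3 * a ^ 3 \<le> 4 / 3 * (1 - a\<^sup>2)\<^sup>2"
    proof -
      have "a * (1 - a) \<le> 1 / 4" using zero_le_power2[of "a - 1 / 2"]
        by (simp add: power2_eq_square algebra_simps)
      then have "a\<^sup>2 * (a * (1 - a)) \<le> a\<^sup>2 * (1 / 4)" by (intro mult_left_mono) auto
      moreover have "0 \<le> a * (7 / 10 - a)" using a by simp
      ultimately show ?thesis using a by (simp add: power2_eq_square power3_eq_cube algebra_simps)
    qed
    ultimately show False using b3 by linarith
  qed
qed

text \<open>Here the inner circle is the critical one: its radius 2 / k = 2 sqrt 2 - 2 is the value
  of \<open>phi_R\<close> at -1.\<close>

lemma exp_cubic_avoids_phi_R:
  fixes v \<zeta> :: complex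
  assumes v: "norm v < 1" and ze: "norm \<zeta> = 1" and \<mu>: "\<mu> > 0" "exp (8 / 9 * \<mu>) = (1 + sqrt 2) / 2"
  shows "exp (of_real \<mu> * (v - v ^ 3 / 9)) \<noteq> phi_R \<zeta>"
proof
  assume eq: "exp (of_real \<mu> * (v - v ^ 3 / 9)) = phi_R \<zeta>"
  define c s r where "c = Re \<zeta>" and "s = Im \<zeta>" and "r = sqrt 2"
  have cs: "c\<^sup>2 + s\<^sup>2 = 1" and c1: "\<bar>c\<bar> \<le> 1"
    using norm_1_components[OF ze] by (auto simp: c_def s_def)
  have r2: "r * r = 2" by (simp add: r_def)
  have r_lo: "1414 / 1000 < r" and r_hi: "r < 1415 / 1000"
    unfolding r_def by (rule real_less_rsqrt real_less_lsqrt; simp add: power2_eq_square)+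
  define k where "k = 1 + r"
  have k: "k > 0" "k * (r - 1) = 1" using r2 r_lo by (auto simp: k_def algebra_simps)
  have rc: "r - c > 0" using r_lo c1 by linarith
  have ne: "of_real k - \<zeta> \<noteq> 0"
  proof
    assume "of_real k - \<zeta> = 0"
    then have "norm \<zeta> = norm (of_real k :: complex)" by simp
    then show False using ze r_lo by (simp add: k_def del: of_real_add)
  qed
  \<comment> \<open>Because k^2 = 2 k + 1, \<open>q\<close> is half of |k - \<zeta>|^2. Multiplying
    \<open>phi_R \<zeta>\<close> by \<open>q\<close> clears the denominator and gives x + i y, with
    squared modulus 2 (1 + c^2) q.\<close>
  define q x y where "q = k * (r - c)" and "x = k - r * c + c\<^sup>2" and "y = s * (1 + c)"
  have q: "q > 0" using k rc by (simp add: q_def)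
  have e1: "x * (k - c) + y * s = (r - c) * (k\<^sup>2 + c\<^sup>2 - s\<^sup>2)"
    and e2: "y * (k - c) - x * s = (r - c) * (2 * c * s)"
    using cs r2 unfolding x_def y_def k_def by (algebra, simp add: algebra_simps power2_eq_square)
  have s2: "s\<^sup>2 = 1 - c\<^sup>2" using cs by simp
  have "x\<^sup>2 + y\<^sup>2 - 2 * (1 + c\<^sup>2) * q = (r * r - 2) * ((1 - c)\<^sup>2 - 2 * (1 + c\<^sup>2))"
    unfolding x_def y_def q_def k_def power_mult_distrib s2
    by (simp add: algebra_simps power2_eq_square)
  then have e3: "x\<^sup>2 + y\<^sup>2 = 2 * (1 + c\<^sup>2) * q"
    using r2 by simp
  have "phi_R \<zeta> = 1 + \<zeta> / of_real k * ((of_real k + \<zeta>) / (of_real k - \<zeta>))"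
    by (simp add: phi_R_def Let_def k_def r_def)
  also have "\<dots> = ((of_real k)\<^sup>2 + \<zeta>\<^sup>2) / (of_real k * (of_real k - \<zeta>))"
    using ne k(1) by (simp add: divide_simps) (simp add: algebra_simps power2_eq_square)
  finally have "phi_R \<zeta> * of_real k * (of_real k - \<zeta>) = (of_real k)\<^sup>2 + \<zeta>\<^sup>2"
    using ne k(1) by (simp add: divide_simps mult.assoc)
  moreover have "Complex x y * (of_real k - \<zeta>) = of_real (r - c) * ((of_real k)\<^sup>2 + \<zeta>\<^sup>2)"
    using e1 e2 by (simp add: complex_eq_iff power2_eq_square c_def s_def)
  moreover have "(phi_R \<zeta> * of_real q) * (of_real k - \<zeta>)
      = of_real (r - c) * (phi_R \<zeta> * of_real k * (of_real k - \<zeta>))"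
    by (simp add: q_def mult_ac)
  ultimately have "(phi_R \<zeta> * of_real q) * (of_real k - \<zeta>) = Complex x y * (of_real k - \<zeta>)"
    by simp
  then have pq: "phi_R \<zeta> * of_real q = Complex x y"
    using ne by simp
  have "Im (phi_R \<zeta>) * q = y" using arg_cong[OF pq, of Im] by simp
  have "(norm (phi_R \<zeta>) * q)\<^sup>2 = x\<^sup>2 + y\<^sup>2"
    using arg_cong[OF pq, of "\<lambda>z. (norm z)\<^sup>2"] q by (simp add: norm_mult cmod_power2)
  then have N: "(norm (phi_R \<zeta>))\<^sup>2 * q = 2 * (1 + c\<^sup>2)"
    unfolding e3 using q by (simp add: power_mult_distrib power2_eq_square)
  have "exp (1 / 5) > (1 + sqrt 2) / 2"
    using exp_lower_Taylor_quadratic[of "1 / 5 :: real"] r_hi by (simp add: power2_eq_square r_def)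
  then have "exp (8 / 9 * \<mu>) < exp (1 / 5)" unfolding \<mu>(2) .
  then have "8 / 9 * \<mu> < 1 / 5" by (simp only: exp_less_cancel_iff)
  then have "10 / 9 * \<mu> \<le> 1 / 4" by simp
  note b = exp_cubic_bounds[OF v \<mu>(1) eq[symmetric]]
  have b1: "norm (phi_R \<zeta>) > 2 / k" using b(1) \<mu>(2) by (simp only: exp_minus) (simp add: k_def r_def)
  have b2: "norm (phi_R \<zeta>) < k / 2" using b(2) \<mu>(2) by (simp add: k_def r_def)
  have b4: "\<bar>Im (phi_R \<zeta>)\<bar> \<le> 1 / 4 * norm (phi_R \<zeta>)" by (rule b(4)) fact
  have N1: "4 * (r - 1)\<^sup>2 * q < 2 * (1 + c\<^sup>2)"
  proof -
    have "1 / k = r - 1" using k by (simp add: field_simps)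
    then have "2 * (r - 1) < norm (phi_R \<zeta>)" using b1 by (simp add: field_simps)
    then have "(2 * (r - 1))\<^sup>2 < (norm (phi_R \<zeta>))\<^sup>2"
      using r_lo by (intro power_strict_mono) auto
    moreover have "(2 * (r - 1))\<^sup>2 = 4 * (r - 1)\<^sup>2" by (simp only: power_mult_distrib) simp
    ultimately have "4 * (r - 1)\<^sup>2 < (norm (phi_R \<zeta>))\<^sup>2" by simp
    then show ?thesis unfolding N[symmetric] using q by (intro mult_strict_right_mono)
  qed
  have N2: "2 * (1 + c\<^sup>2) < k\<^sup>2 / 4 * q"
  proof -
    have "(norm (phi_R \<zeta>))\<^sup>2 < (k / 2)\<^sup>2" by (rule power_strict_mono[OF b2]) auto
    then show ?thesis unfolding N[symmetric] using q by (simp add: power_divide)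
  qed
  have N3: "8 * y\<^sup>2 \<le> (1 + c\<^sup>2) * q"
  proof -
    have "\<bar>y\<bar> = \<bar>Im (phi_R \<zeta>)\<bar> * q"
      using q by (simp add: \<open>Im (phi_R \<zeta>) * q = y\<close>[symmetric] abs_mult)
    also have "\<dots> \<le> 1 / 4 * norm (phi_R \<zeta>) * q" using b4 q by (intro mult_right_mono) auto
    finally have "\<bar>y\<bar>\<^sup>2 \<le> (1 / 4 * norm (phi_R \<zeta>) * q)\<^sup>2" by (rule power_mono) simp
    also have "\<dots> = 1 / 16 * ((norm (phi_R \<zeta>))\<^sup>2 * q) * q" by (simp add: power2_eq_square)
    finally show ?thesis unfolding N by (simp add: algebra_simps)
  qed
  have k_hi: "k \<le> 2415 / 1000" using r_hi by (simp add: k_def)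
  \<comment> \<open>The modulus is at most 2 / k in the first range and at least k / 2 in the
    second; in between the argument is too large. The ranges cover the circle since 3 - 2 sqrt 2
    exceeds 17/100.\<close>
  consider "c \<le> 3 - 2 * r" | "c \<ge> 65 / 100" | "17 / 100 \<le> c" "c \<le> 65 / 100"
    using r_hi by linarith
  then show False
  proof cases
    case 1
    have "(c + 1) * (c + 2 * r - 3) \<le> 0" using 1 c1 by (intro mult_nonneg_nonpos) auto
    moreover have "4 * (r - 1)\<^sup>2 * q - 2 * (1 + c\<^sup>2) = - 2 * ((c + 1) * (c + 2 * r - 3))
        + (r * r - 2) * (4 * ((r - 1) * (r - c)) + 4)"
      unfolding q_def k_def by (simp add: algebra_simps power2_eq_square)
    ultimately show False using N1 r2 by simp
  next
    case 2
    have "k\<^sup>2 / 4 * q = k ^ 3 / 4 * (r - c)" by (simp add: q_def power2_eq_square power3_eq_cube)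
    also have "\<dots> \<le> (2415 / 1000) ^ 3 / 4 * (1415 / 1000 - 65 / 100)"
      using power_mono[OF k_hi, of 3] k(1) rc r_hi 2 by (intro mult_mono) auto
    finally show False
      using N2 power_mono[OF 2, of 2] by (simp add: power2_eq_square power3_eq_cube)
  next
    case 3
    have c2: "c\<^sup>2 \<le> (65 / 100)\<^sup>2" using 3 by (intro power_mono) auto
    have "(17 / 100 + 1)\<^sup>2 \<le> (1 + c)\<^sup>2" using 3 by (intro power_mono) auto
    then have "(1 - (65 / 100)\<^sup>2) * (17 / 100 + 1)\<^sup>2 \<le> s\<^sup>2 * (1 + c)\<^sup>2"
      using c2 cs by (intro mult_mono) (auto simp: power2_eq_square)
    moreover have "(1 + c\<^sup>2) * (k * (r - c)) \<le> (1 + (65 / 100)\<^sup>2) * (2415 / 1000 * (1415 / 1000 - 17 / 100))"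
      using c2 k_hi k(1) rc r_hi 3 by (intro mult_mono) auto
    moreover have "8 * (s\<^sup>2 * (1 + c)\<^sup>2) \<le> (1 + c\<^sup>2) * (k * (r - c))"
      using N3 by (simp add: y_def q_def power_mult_distrib)
    ultimately show False by (simp add: power2_eq_square)
  qed
qed

section \<open>Elementary bounds for sin, cos, sinh and cosh\<close>

lemma nondecreasing_from_0:
  fixes f :: "real \<Rightarrow> real"
  assumes "x \<ge> 0" "\<And>t. t \<ge> 0 \<Longrightarrow> (f has_real_derivative f' t) (at t)" "\<And>t. t \<ge> 0 \<Longrightarrow> f' t \<ge> 0"
  shows "f 0 \<le> f x"
  by (rule DERIV_nonneg_imp_nondecreasing[OF assms(1)]) (use assms in auto)

lemma cos_ge_quadratic: "1 - x\<^sup>2 / 2 \<le> cos (x :: real)"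
proof -
  have "(sin (x / 2))\<^sup>2 \<le> (x / 2)\<^sup>2"
    using power_mono[OF abs_sin_x_le_abs_x[of "x / 2"], of 2] by (simp add: power_divide)
  then show ?thesis using cos_double_sin[of "x / 2"] by (simp add: power_divide)
qed

lemma sin_ge_cubic: "x - x ^ 3 / 6 \<le> sin x" if "x \<ge> 0" for x :: real
proof -
  have "sin 0 - 0 + (0::real) ^ 3 / 6 \<le> sin x - x + x ^ 3 / 6"
    by (rule nondecreasing_from_0[where f' = "\<lambda>t. cos t - 1 + t\<^sup>2 / 2", OF that])
      (use cos_ge_quadratic in \<open>auto intro!: derivative_eq_intros simp: field_simps\<close>)
  then show ?thesis by simp
qed

lemma sinh_ge_self: "x \<le> sinh x" if "x \<ge> 0" for x :: real
proof -
  have "sinh 0 - (0::real) \<le> sinh x - x"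
    by (rule nondecreasing_from_0[where f' = "\<lambda>t. cosh t - 1", OF that])
      (auto intro!: derivative_eq_intros simp: cosh_real_ge_1)
  then show ?thesis by simp
qed

lemma cosh_ge_quadratic: "1 + x\<^sup>2 / 2 \<le> cosh x" for x :: real
proof -
  have "cosh 0 - 1 - (0::real)\<^sup>2 / 2 \<le> cosh \<bar>x\<bar> - 1 - \<bar>x\<bar>\<^sup>2 / 2"
    by (rule nondecreasing_from_0[where f' = "\<lambda>t. sinh t - t"])
      (use sinh_ge_self in \<open>auto intro!: derivative_eq_intros\<close>)
  then show ?thesis by simp
qed

lemma sinh_ge_cubic: "x + x ^ 3 / 6 \<le> sinh x" if "x \<ge> 0" for x :: real
proof -
  have "sinh 0 - 0 - (0::real) ^ 3 / 6 \<le> sinh x - x - x ^ 3 / 6"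
    by (rule nondecreasing_from_0[where f' = "\<lambda>t. cosh t - 1 - t\<^sup>2 / 2", OF that])
      (use cosh_ge_quadratic in \<open>auto intro!: derivative_eq_intros simp: field_simps\<close>)
  then show ?thesis by simp
qed

text \<open>This is tanh t <= t at t = |x| / 2, rewritten by the double-argument formula.\<close>

lemma cosh_le_rational: "cosh x * (1 - x\<^sup>2 / 4) \<le> 1 + x\<^sup>2 / 4" for x :: real
proof -
  define t where "t = \<bar>x\<bar> / 2"
  have t: "t \<ge> 0" by (simp add: t_def)
  have "0 * cosh 0 - sinh (0::real) \<le> t * cosh t - sinh t"
    by (rule nondecreasing_from_0[where f' = "\<lambda>t. t * sinh t", OF t])
      (auto intro!: derivative_eq_intros)
  then have "(sinh t)\<^sup>2 \<le> (t * cosh t)\<^sup>2"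
    using t by (intro power_mono) auto
  moreover have "(sinh t)\<^sup>2 = (cosh t)\<^sup>2 - 1" by (simp add: cosh_square_eq)
  ultimately have "(cosh t)\<^sup>2 - 1 \<le> t\<^sup>2 * (cosh t)\<^sup>2"
    by (simp add: power_mult_distrib)
  moreover have "cosh x = 2 * (cosh t)\<^sup>2 - 1" "x\<^sup>2 / 4 = t\<^sup>2"
    using cosh_double_cosh[of t] by (simp_all add: t_def power_divide)
  ultimately show ?thesis
    by (simp only:) (simp add: algebra_simps)
qed

lemma cos_le_quartic: "cos x \<le> 1 - x\<^sup>2 / 2 + x ^ 4 / 24" if "x \<ge> 0" for x :: real
proof -
  have "1 - (0::real)\<^sup>2 / 2 + 0 ^ 4 / 24 - cos 0 \<le> 1 - x\<^sup>2 / 2 + x ^ 4 / 24 - cos x"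
    by (rule nondecreasing_from_0[where f' = "\<lambda>t. sin t - (t - t ^ 3 / 6)", OF that])
      (use sin_ge_cubic in \<open>auto intro!: derivative_eq_intros simp: field_simps\<close>)
  then show ?thesis by simp
qed

lemma sin_le_quintic: "sin x \<le> x - x ^ 3 / 6 + x ^ 5 / 120" if "x \<ge> 0" for x :: real
proof -
  have "(0::real) - 0 ^ 3 / 6 + 0 ^ 5 / 120 - sin 0 \<le> x - x ^ 3 / 6 + x ^ 5 / 120 - sin x"
    by (rule nondecreasing_from_0[where f' = "\<lambda>t. 1 - t\<^sup>2 / 2 + t ^ 4 / 24 - cos t", OF that])
      (use cos_le_quartic in \<open>auto intro!: derivative_eq_intros simp: field_simps\<close>)
  then show ?thesis by simp
qed

lemma sin_1_le: "sin 1 \<le> (842 / 1000 :: real)"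
  using sin_le_quintic[of 1] by simp

lemma cos_1_le: "cos 1 \<le> (542 / 1000 :: real)"
  using cos_le_quartic[of 1] by simp

text \<open>The deficit is matched to cosh S >= 1 + S^2 / 2 with S^2 = 1 - c^2. Expanding at 1 with
  t = 1 - c reduces the claim to t (1 + sin 1) <= 2 (1 - cos 1), which the numerical bounds give up
  to t = 0.48.\<close>

lemma sin_ge_near_1:
  fixes c :: real assumes "52 / 100 \<le> c" "c \<le> 1"
  shows "sin c \<ge> sin 1 - (1 - c\<^sup>2) / 2"
proof -
  define t where "t = 1 - c"
  have t: "0 \<le> t" "t \<le> 48 / 100" using assms by (auto simp: t_def)
  have pos: "sin (1::real) \<ge> 0" "cos (1::real) \<ge> 0"
    using pi_gt3 by (auto intro!: sin_ge_zero cos_ge_zero)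
  have "sin 1 * (1 - t\<^sup>2 / 2) \<le> sin 1 * cos t"
    using cos_ge_quadratic[of t] pos by (intro mult_left_mono) auto
  moreover have "cos 1 * sin t \<le> cos 1 * t"
    using sin_x_le_x[OF t(1)] pos by (intro mult_left_mono) auto
  moreover have "sin c = sin 1 * cos t - cos 1 * sin t"
    using sin_diff[of 1 t] by (simp add: t_def)
  moreover have "t * (t * (1 + sin 1)) \<le> t * (2 * (1 - cos 1))"
  proof (rule mult_left_mono[OF _ t(1)])
    have "t * (1 + sin 1) \<le> 48 / 100 * (1 + 842 / 1000)"
      using t pos sin_1_le by (intro mult_mono) auto
    also have "\<dots> \<le> 2 * (1 - cos 1)" using cos_1_le by simp
    finally show "t * (1 + sin 1) \<le> 2 * (1 - cos 1)" .
  qed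
  moreover have "(1 - c\<^sup>2) / 2 = t - t\<^sup>2 / 2"
    by (simp add: t_def power2_eq_square field_simps)
  ultimately show ?thesis by (simp add: power2_eq_square algebra_simps)
qed

section \<open>The sine target on the unit circle\<close>

lemma Re_phi_S: "Re (phi_S z) = 1 + sin (Re z) * cosh (Im z)"
  and Im_phi_S: "Im (phi_S z) = cos (Re z) * sinh (Im z)"
  by (simp_all add: phi_S_def Re_sin Im_sin cosh_field_def sinh_field_def)

text \<open>Eliminating cos^2 and sinh^2 turns the squared modulus into a perfect square.\<close>

lemma norm_phi_S: "norm (phi_S z) = cosh (Im z) + sin (Re z)"
proof -
  have "(norm (phi_S z))\<^sup>2 = (cosh (Im z) + sin (Re z))\<^sup>2"
    unfolding cmod_power2 Re_phi_S Im_phi_S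
    using cosh_square_eq[of "Im z"] sin_cos_squared_add[of "Re z"] by algebra
  moreover have "0 \<le> cosh (Im z) + sin (Re z)"
    using cosh_real_ge_1[of "Im z"] sin_ge_minus_one[of "Re z"] by linarith
  ultimately show ?thesis by simp
qed

text \<open>The modulus settles \<open>Re \<zeta>\<close> near \<open>1\<close> and near \<open>-1\<close>, and the argument the rest of the left half of the
  circle. For \<open>0 \<le> Re \<zeta> \<le> 0.52\<close> neither is enough, and the support line
  \<open>2 Re Q + \<bar>Im Q\<bar> \<le> 2.21\<close> of \<open>Q (D)\<close> is needed.\<close>

lemma exp_cubic_avoids_phi_S:
  fixes v \<zeta> :: complex
  assumes v: "norm v < 1" and ze: "norm \<zeta> = 1" and \<mu>: "\<mu> > 0" "exp (8 / 9 * \<mu>) = 1 + sin 1"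
  shows "exp (of_real \<mu> * (v - v ^ 3 / 9)) \<noteq> phi_S \<zeta>"
proof
  assume eq: "exp (of_real \<mu> * (v - v ^ 3 / 9)) = phi_S \<zeta>"
  define c S where "c = Re \<zeta>" and "S = \<bar>Im \<zeta>\<bar>"
  have cS: "c\<^sup>2 + S\<^sup>2 = 1" and c1: "\<bar>c\<bar> \<le> 1" and S: "0 \<le> S" "S \<le> 1"
    using norm_1_components[OF ze] by (auto simp: c_def S_def)
  have S2: "S\<^sup>2 = 1 - c\<^sup>2" using cS by simp
  have SS2: "1 - c\<^sup>2 \<le> S" using mult_right_mono[OF S(2,1)] S2 by (simp add: power2_eq_square)
  have cosc: "cos c \<ge> 0" using c1 pi_gt3 by (intro cos_ge_zero) auto
  have N: "norm (phi_S \<zeta>) = cosh S + sin c"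
    by (simp add: norm_phi_S c_def S_def)
  have X: "Re (phi_S \<zeta>) = 1 + sin c * cosh S"
    by (simp add: Re_phi_S c_def S_def)
  have Y: "\<bar>Im (phi_S \<zeta>)\<bar> = cos c * sinh S"
    using cosc by (simp add: Im_phi_S c_def S_def abs_mult)
  have sin1: "sin (1::real) \<ge> 0" using pi_gt3 by (intro sin_ge_zero) auto
  \<comment> \<open>The quadratic Taylor bound at 5/8 is too weak, so the one at 5/16 is squared.
    The exponent 5/8 yields 10/9 \<mu> < 25/32, just below pi/4.\<close>
  have "(1 + 5 / 16 + (5 / 16)\<^sup>2 / 2)\<^sup>2 \<le> (exp (5 / 16 :: real))\<^sup>2"
    using exp_lower_Taylor_quadratic[of "5 / 16 :: real"] by (intro power_mono) auto
  also have "\<dots> = exp (5 / 8 :: real)" by (simp flip: exp_double)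
  finally have "1 + sin 1 < exp (5 / 8 :: real)"
    using sin_1_le by (simp add: power2_eq_square)
  then have "exp (8 / 9 * \<mu>) < exp (5 / 8)" unfolding \<mu>(2) .
  then have "8 / 9 * \<mu> < 5 / 8" by (simp only: exp_less_cancel_iff)
  then have \<mu>4: "10 / 9 * \<mu> \<le> pi / 4" using pi_approx(1) by simp
  note b = exp_cubic_bounds[OF v \<mu>(1) eq[symmetric]]
  have b1: "norm (phi_S \<zeta>) * (1 + sin 1) > 1"
    using b(1) sin1 unfolding exp_minus \<mu>(2) by (simp add: field_simps)
  have b2: "norm (phi_S \<zeta>) < 1 + sin 1" using b(2) \<mu>(2) by simp
  have b3: "\<bar>Im (phi_S \<zeta>)\<bar> < Re (phi_S \<zeta>)" by (rule b(3)) fact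
  have b5: "(norm (phi_S \<zeta>))\<^sup>2 + norm (phi_S \<zeta>) * \<bar>Im (phi_S \<zeta>)\<bar> + \<bar>Im (phi_S \<zeta>)\<bar>\<^sup>2 / 2 \<le> 461 / 100"
  proof -
    \<comment> \<open>Since 2 * 2.21 < 5 * 8/9, the square is bounded by the fifth power of 1 + sin
      1.\<close>
    have "(exp (221 / 100 * \<mu>))\<^sup>2 \<le> (exp (8 / 9 * \<mu>)) ^ 5"
      using \<mu>(1) by (simp flip: exp_double exp_of_nat_mult)
    also have "\<dots> \<le> (1 + 842 / 1000) ^ 5"
      unfolding \<mu>(2) using sin_1_le sin1 by (intro power_mono) auto
    also have "\<dots> \<le> (461 / 100)\<^sup>2" by (simp add: power_divide)
    finally have "exp (221 / 100 * \<mu>) \<le> 461 / 100"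
      by (rule power2_le_imp_le) simp
    then show ?thesis using b(5) by simp
  qed
  consider "c \<ge> 52 / 100" | "0 \<le> c" "c \<le> 52 / 100" | "- (8 / 10) \<le> c" "c \<le> 0" | "c \<le> - (8 / 10)"
    by linarith
  then show False
  proof cases
    case 1
    then show False
      using sin_ge_near_1[of c] cosh_ge_quadratic[of S] c1 b2 unfolding N S2 by simp
  next
    case 2
    have cc: "c\<^sup>2 \<le> 52 / 100 * c" "c\<^sup>2 \<ge> 0"
      using mult_right_mono[OF 2(2,1)] by (auto simp: power2_eq_square)
    have "c ^ 3 \<le> (52 / 100)\<^sup>2 * c"
      using mult_mono[OF 2(2) cc(1)] 2 by (simp add: power2_eq_square power3_eq_cube)
    then have M: "norm (phi_S \<zeta>) \<ge> 3 / 2 + 69 / 100 * c"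
      using sin_ge_cubic[OF 2(1)] cosh_ge_quadratic[of S] cc(1) 2(1)
      unfolding N S2 by (simp add: field_simps)
    have Yl: "\<bar>Im (phi_S \<zeta>)\<bar> \<ge> 7 / 6 - c"
    proof -
      define u where "u = c\<^sup>2"
      have u: "0 \<le> u" "u \<le> 52 / 100 * c" "u \<le> 3 / 10"
        using cc 2 by (auto simp: u_def)
      have uu: "0 \<le> u * u" "u * u \<le> 3 / 10 * u" "u * u * u \<le> u * u"
        using mult_right_mono[OF u(3,1)] mult_left_mono[of u 1 "u * u"] u by auto
      have "(1 - u) + (1 - u)\<^sup>2 / 6 \<le> S + S ^ 3 / 6"
      proof -
        have "(1 - u)\<^sup>2 = S\<^sup>2 * S\<^sup>2"
          unfolding u_def S2[symmetric] by (simp add: power2_eq_square)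
        also have "\<dots> \<le> S\<^sup>2 * S"
          using S by (intro mult_left_mono) (auto simp: power2_eq_square mult_left_le)
        finally show ?thesis
          using SS2 by (simp add: u_def power2_eq_square power3_eq_cube)
      qed
      also have "\<dots> \<le> sinh S" using sinh_ge_cubic[OF S(1)] .
      finally have "(1 - u / 2) * ((1 - u) + (1 - u)\<^sup>2 / 6) \<le> cos c * sinh S"
        using cos_ge_quadratic[of c] u cosc by (intro mult_mono) (auto simp: u_def)
      moreover have "(1 - u / 2) * ((1 - u) + (1 - u)\<^sup>2 / 6)
          = 7 / 6 - 23 / 12 * u + 5 / 6 * (u * u) - (u * u * u) / 12"
        by (simp add: power2_eq_square field_simps)
      ultimately show ?thesis unfolding Y using u uu by linarith
    qed
    \<comment> \<open>The left side of \<open>b5\<close> increases with the modulus and with |Im|,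
      so their linear lower bounds may be inserted. The constants 3/2 and 7/6 are the truncated
      Taylor values of cosh 1 and sinh 1, reached at c = 0; the sum is at least 4 + 49/72 >
      461/100.\<close>
    have "(3 / 2 + 69 / 100 * c)\<^sup>2 + (3 / 2 + 69 / 100 * c) * (7 / 6 - c) + (7 / 6 - c)\<^sup>2 / 2
      \<le> (norm (phi_S \<zeta>))\<^sup>2 + norm (phi_S \<zeta>) * \<bar>Im (phi_S \<zeta>)\<bar> + \<bar>Im (phi_S \<zeta>)\<bar>\<^sup>2 / 2"
      using M Yl 2 by (intro add_mono power_mono mult_mono divide_right_mono) auto
    moreover have "(3 / 2 + 69 / 100 * c)\<^sup>2 + (3 / 2 + 69 / 100 * c) * (7 / 6 - c) + (7 / 6 - c)\<^sup>2 / 2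
      = 4 + 49 / 72 + 5 / 24 * c + 2861 / 10000 * c\<^sup>2"
      by (simp add: power2_eq_square field_simps)
    ultimately show False using b5 2(1) cc(2) by linarith
  next
    case 3
    define a where "a = - c"
    have a: "0 \<le> a" "a \<le> 8 / 10" using 3 by (auto simp: a_def)
    have "a\<^sup>2 \<le> 1" using a by (simp add: power_le_one)
    have sa: "a - a ^ 3 / 6 \<le> sin a" using a by (intro sin_ge_cubic)
    have "a ^ 3 \<le> 1 ^ 2 * a" using a \<open>a\<^sup>2 \<le> 1\<close> mult_right_mono[of "a\<^sup>2" 1 a] by (simp add: power2_eq_square power3_eq_cube)
    then have "(a - a ^ 3 / 6) * (1 + S\<^sup>2 / 2) \<le> sin a * cosh S"
      using sa a cosh_ge_quadratic[of S] by (intro mult_mono) auto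
    moreover have "(1 - a\<^sup>2 / 2) * (1 - a\<^sup>2) \<le> cos a * sinh S"
      using cos_ge_quadratic[of a] SS2 sinh_ge_self[OF S(1)] \<open>a\<^sup>2 \<le> 1\<close> S cosc
      by (intro mult_mono) (auto simp: a_def)
    moreover have "1 - (a - a ^ 3 / 6) * (1 + (1 - a\<^sup>2) / 2) \<le> (1 - a\<^sup>2 / 2) * (1 - a\<^sup>2)"
    proof -
      \<comment> \<open>The difference of the two sides is \<open>a\<close> times a quartic, written
        here as a sum of terms that are nonnegative on [0, 8/10].\<close>
      have "0 \<le> a ^ 4 / 12" by simp
      moreover have "0 \<le> (8 / 10 - a) * (178 / 100 + a * (35 / 100 - a / 2))"
      proof (intro mult_nonneg_nonneg)
        have "a * a \<le> 1 * 1" using a by (intro mult_mono) auto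
        then show "0 \<le> 178 / 100 + a * (35 / 100 - a / 2)" using a by (simp add: algebra_simps)
      qed (use a in auto)
      ultimately have "0 \<le> a ^ 4 / 12 + 76 / 1000 + (8 / 10 - a) * (178 / 100 + a * (35 / 100 - a / 2))"
        by linarith
      then have "0 \<le> a * (a ^ 4 / 12 + 76 / 1000 + (8 / 10 - a) * (178 / 100 + a * (35 / 100 - a / 2)))"
        by (rule mult_nonneg_nonneg[OF a(1)])
      also have "\<dots> = (1 - a\<^sup>2 / 2) * (1 - a\<^sup>2) - (1 - (a - a ^ 3 / 6) * (1 + (1 - a\<^sup>2) / 2))"
        by (simp add: power2_eq_square power3_eq_cube power4_eq_xxxx field_simps)
      finally show ?thesis by simp
    qed
    ultimately show False using b3 unfolding X Y S2 by (simp add: a_def)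
  next
    case 4
    define a where "a = - c"
    have a: "8 / 10 \<le> a" "a \<le> 1" using 4 c1 by (auto simp: a_def)
    have "(8 / 10)\<^sup>2 \<le> a\<^sup>2" using a by (intro power_mono) auto
    then have S2': "S\<^sup>2 \<le> 36 / 100" unfolding S2 a_def by (simp add: power2_eq_square)
    have "cosh S * (1 - 9 / 100) \<le> cosh S * (1 - S\<^sup>2 / 4)"
      using S2' by (intro mult_left_mono) auto
    also have "\<dots> \<le> 1 + 9 / 100" using cosh_le_rational[of S] S2' by simp
    finally have "cosh S \<le> 12 / 10" by simp
    moreover have "sin a \<ge> 71 / 100"
    proof -
      \<comment> \<open>Again the chord of the cube, now over [8/10, 1].\<close>
      have "0 \<le> (a - 8 / 10) * (1 - a) * (a + 18 / 10)" using a by simp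
      then have "a ^ 3 \<le> 244 / 100 * a - 144 / 100"
        by (simp add: power3_eq_cube field_simps)
      then show ?thesis using sin_ge_cubic[of a] a by linarith
    qed
    ultimately have "norm (phi_S \<zeta>) \<le> 49 / 100" unfolding N a_def by simp
    then have "norm (phi_S \<zeta>) * (1 + sin 1) \<le> 49 / 100 * (1 + 842 / 1000)"
      using sin1 sin_1_le by (intro mult_mono) auto
    then show False using b1 by simp
  qed
qed

section \<open>The subordination and its sharpness\<close>

text \<open>The difference of two values is (a - b) (q - (a^2 + a b + b^2)) / q, and the quadratic
  form is smaller than 3 R^2 in modulus. Used with q = 9 on a disk larger than the unit disk, and
  with q = 3 for \<open>phi_Ne\<close>.\<close>

lemma inj_on_cubic:
  assumes "R\<^sup>2 * 3 \<le> norm q" "q \<noteq> (0::complex)"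
  shows "inj_on (\<lambda>z. z - z ^ 3 / q) (ball 0 R)"
proof (rule inj_onI)
  fix a b :: complex
  assume ab: "a \<in> ball 0 R" "b \<in> ball 0 R" and eq: "a - a ^ 3 / q = b - b ^ 3 / q"
  have "norm (a\<^sup>2 + a * b + b\<^sup>2) \<le> norm a * norm a + norm a * norm b + norm b * norm b"
    by (intro order_trans[OF norm_triangle_ineq] add_mono) (auto simp: norm_mult power2_eq_square)
  also have "\<dots> < R * R + R * R + R * R"
    using ab by (intro add_strict_mono mult_strict_mono') auto
  also have "\<dots> \<le> norm q" using assms(1) by (simp add: power2_eq_square)
  finally have "q - (a\<^sup>2 + a * b + b\<^sup>2) \<noteq> 0" by auto
  moreover have "(a - b) * (q - (a\<^sup>2 + a * b + b\<^sup>2)) = q * ((a - a ^ 3 / q) - (b - b ^ 3 / q))"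
    using assms(2) by (simp add: field_simps power2_eq_square power3_eq_cube)
  ultimately show "a = b" using eq by simp
qed

lemma deriv_scaled_cubic:
  "((\<lambda>z. of_real \<mu> * (z - z ^ 3 / 9)) has_field_derivative of_real \<mu> * (1 - \<zeta>\<^sup>2 / 3)) (at \<zeta>)"
  for \<zeta> :: complex
  by (auto intro!: derivative_eq_intros)

lemma starlike_class_if_avoids_boundary:
  assumes f: "f \<in> class_A" "subordinate (beta_expr \<beta> f) phi_Ne"
    and \<mu>: "\<mu> > 0" "\<beta> * \<mu> \<ge> 1"
    and phi: "\<phi> holomorphic_on ball 0 1" "continuous_on (cball 0 1) \<phi>"
      "inj_on \<phi> (ball 0 1)" "\<phi> 0 = 1"
    and avoid: "\<And>v \<zeta>. norm v < 1 \<Longrightarrow> norm \<zeta> = 1 \<Longrightarrow> exp (of_real \<mu> * (v - v ^ 3 / 9)) \<noteq> \<phi> \<zeta>"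
  shows "f \<in> starlike_class \<phi>"
proof -
  define g where "g = (\<lambda>z::complex. of_real \<mu> * (z - z ^ 3 / 9))"
  obtain w where hol: "beta_expr \<beta> f holomorphic_on ball 0 1"
    and w: "w 0 = 0" "\<And>z. norm z < 1 \<Longrightarrow> norm (w z) < 1"
      "\<And>z. norm z < 1 \<Longrightarrow> beta_expr \<beta> f z = phi_Ne (w z)"
    using f(2) unfolding subordinate_def by auto
  have \<beta>: "\<beta> > 0"
  proof (rule ccontr)
    assume "\<not> \<beta> > 0"
    then have "\<beta> * \<mu> \<le> 0" using \<mu>(1) by (simp add: mult_nonpos_nonneg)
    then show False using \<mu>(2) by simp
  qed
  have "beta_expr \<beta> f 0 = 1" using w(3)[of 0] by (simp add: w(1) phi_Ne_def)
  then obtain G where G: "G holomorphic_on ball 0 1" "G 0 = 0"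
    "\<And>z. z \<in> ball 0 1 \<Longrightarrow> beta_expr \<beta> f z = 1 + of_real \<beta> * (z * deriv G z)"
    "\<And>z. z \<in> ball 0 1 \<Longrightarrow> remove_sings (\<lambda>z. z * deriv f z / f z) z = exp (G z)"
    using class_A_exponential_form[OF f(1) _ hol] \<beta> by auto
  have holg: "g holomorphic_on S" for S unfolding g_def by (intro holomorphic_intros) auto
  have "G ` ball 0 1 \<subseteq> g ` ball 0 1"
  proof (rule miller_mocanu_subset[OF G(1) holg, of "3 / 2"])
    show "inj_on g (ball 0 (3 / 2))"
    proof -
      have "inj_on (\<lambda>z::complex. z - z ^ 3 / 9) (ball 0 (3 / 2))"
        by (rule inj_on_cubic) (auto simp: power2_eq_square)
      then show ?thesis using \<mu>(1) by (simp add: g_def inj_on_def)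
    qed
    show "z * deriv G z \<noteq> of_real m * (\<zeta> * deriv g \<zeta>)"
      if z: "norm z < 1" and \<zeta>: "norm \<zeta> = 1" and m: "m \<ge> 1" for z \<zeta> m
    proof
      assume "z * deriv G z = of_real m * (\<zeta> * deriv g \<zeta>)"
      moreover have "deriv g \<zeta> = of_real \<mu> * (1 - \<zeta>\<^sup>2 / 3)"
        unfolding g_def by (rule DERIV_imp_deriv[OF deriv_scaled_cubic])
      moreover have "w z - w z ^ 3 / 3 = of_real \<beta> * (z * deriv G z)"
        using G(3)[of z] w(3)[of z] z by (simp add: phi_Ne_def)
      \<comment> \<open>Since \<zeta> g'(\<zeta>) = \<mu> h(\<zeta>), a contact point would give h(w
        z) = \<beta> \<mu> m h(\<zeta>) with a factor of at least one.\<close>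
      ultimately have "w z - w z ^ 3 / 3 = of_real \<beta> * (of_real m * (\<zeta> * (of_real \<mu> * (1 - \<zeta>\<^sup>2 / 3))))"
        by simp
      also have "\<dots> = of_real (\<beta> * \<mu> * m) * (\<zeta> - \<zeta> ^ 3 / 3)"
        by (simp add: power2_eq_square power3_eq_cube algebra_simps)
      finally have "w z - w z ^ 3 / 3 = of_real (\<beta> * \<mu> * m) * (\<zeta> - \<zeta> ^ 3 / 3)" .
      moreover have "\<beta> * \<mu> * m \<ge> 1" using mult_mono[OF \<mu>(2) m] \<mu>(1) \<beta> by simp
      ultimately show False using cubic_starlike_exterior[OF w(2)[OF z] \<zeta>] by blast
    qed
  qed (auto simp: G(2) g_def)
  moreover have "(\<lambda>v. exp (g v)) ` ball 0 1 \<subseteq> \<phi> ` ball 0 1"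
  proof (rule image_subset_if_avoids_boundary[OF _ phi(1-3)])
    show "continuous_on (ball 0 1) (\<lambda>v. exp (g v))"
      unfolding g_def by (intro continuous_intros) auto
  qed (use avoid in \<open>auto simp: g_def phi(4)\<close>)
  ultimately have sub: "(\<lambda>z. exp (G z)) ` ball 0 1 \<subseteq> \<phi> ` ball 0 1"
    by (fastforce simp: image_subset_iff)
  have "subordinate (\<lambda>z. exp (G z)) \<phi>"
    by (rule subordinate_by_image[OF _ phi(1,3) _ sub])
      (use G(1,2) phi(4) in \<open>auto intro: holomorphic_on_exp'\<close>)
  moreover have "remove_sings (\<lambda>z. z * deriv f z / f z) holomorphic_on ball 0 1"
    by (rule holomorphic_transform[OF holomorphic_on_exp'[OF G(1)]]) (simp add: G(4))
  ultimately have "subordinate (remove_sings (\<lambda>z. z * deriv f z / f z)) \<phi>"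
    unfolding subordinate_def using G(4) by auto
  then show ?thesis using f(1) by (simp add: starlike_class_def)
qed

text \<open>The extremal function has \<open>z f' / f = exp ((z - z^3 / 9) / \<beta>)\<close>; for \<open>\<beta>\<close> below the bound this
  quotient takes the boundary value of \<open>\<phi>\<close> at \<open>1\<close> or \<open>-1\<close> at an interior point of the real diameter.\<close>

lemma starlike_bound_sharp:
  assumes \<mu>: "\<mu> > 0" and c: "c < 1 / \<mu>" and \<epsilon>: "\<epsilon> = 1 \<or> \<epsilon> = (- 1 :: real)"
    and omit: "\<And>w. norm w < 1 \<Longrightarrow> \<phi> w \<noteq> of_real (exp (\<epsilon> * (8 / 9 * \<mu>)))"
  shows "\<not> (\<forall>\<beta>\<ge>c. \<forall>f\<in>class_A. subordinate (beta_expr \<beta> f) phi_Ne \<longrightarrow> f \<in> starlike_class \<phi>)"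
proof
  assume all: "\<forall>\<beta>\<ge>c. \<forall>f\<in>class_A. subordinate (beta_expr \<beta> f) phi_Ne \<longrightarrow> f \<in> starlike_class \<phi>"
  \<comment> \<open>The maximum keeps \<open>\<beta>\<close> positive even when \<open>c\<close> is
    not.\<close>
  define \<beta> where "\<beta> = max c (1 / (2 * \<mu>))"
  have \<beta>: "\<beta> \<ge> c" "\<beta> * \<mu> < 1"
    using \<mu> c by (auto simp: \<beta>_def max_def field_simps)
  have "0 < 1 / (2 * \<mu>)" using \<mu> by simp
  then have \<beta>0: "\<beta> > 0" by (simp add: \<beta>_def less_max_iff_disj)
  define G where "G = (\<lambda>z::complex. of_real (1 / \<beta>) * (z - z ^ 3 / 9))"
  have holG: "G holomorphic_on ball 0 1" unfolding G_def by (intro holomorphic_intros) auto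
  have G0: "G 0 = 0" by (simp add: G_def)
  have dG: "deriv G z = of_real (1 / \<beta>) * (1 - z\<^sup>2 / 3)" for z
    unfolding G_def by (rule DERIV_imp_deriv[OF deriv_scaled_cubic])
  obtain f where f: "f \<in> class_A"
    "\<And>\<beta> z. z \<in> ball 0 1 \<Longrightarrow> beta_expr \<beta> f z = 1 + of_real \<beta> * (z * deriv G z)"
    "\<And>z. z \<in> ball 0 1 \<Longrightarrow> remove_sings (\<lambda>z. z * deriv f z / f z) z = exp (G z)"
    using class_A_from_exponent[OF holG G0] by blast
  have be: "beta_expr \<beta> f z = phi_Ne z" if "z \<in> ball 0 1" for z
    using f(2)[OF that, of \<beta>] \<beta>0
    by (simp add: dG phi_Ne_def power2_eq_square power3_eq_cube algebra_simps)
  have "phi_Ne holomorphic_on ball 0 1"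
    unfolding phi_Ne_def by (intro holomorphic_intros) auto
  moreover from this have "beta_expr \<beta> f holomorphic_on ball 0 1"
    by (rule holomorphic_transform) (simp add: be)
  ultimately have "subordinate (beta_expr \<beta> f) phi_Ne"
    unfolding subordinate_def using be by (auto intro!: exI[of _ "\<lambda>z. z"])
  then have "f \<in> starlike_class \<phi>" using all \<beta>(1) f(1) by blast
  then obtain w where w: "\<And>z. z \<in> ball 0 1 \<Longrightarrow> norm (w z) < 1"
    "\<And>z. z \<in> ball 0 1 \<Longrightarrow> remove_sings (\<lambda>z. z * deriv f z / f z) z = \<phi> (w z)"
    unfolding starlike_class_def subordinate_def mem_Collect_eq by blast
  \<comment> \<open>As \<beta> \<mu> < 1, the target lies strictly below Q(1) = 8/9, so the
    intermediate value is taken at an interior point.\<close>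
  have "\<exists>t. 0 \<le> t \<and> t \<le> 1 \<and> t - t ^ 3 / 9 = \<beta> * (8 / 9 * \<mu>)"
  proof (rule IVT')
    show "(0::real) - 0 ^ 3 / 9 \<le> \<beta> * (8 / 9 * \<mu>)" using \<beta>0 \<mu> by simp
    show "\<beta> * (8 / 9 * \<mu>) \<le> 1 - 1 ^ 3 / 9" using \<beta>(2) by simp
  qed (auto intro!: continuous_intros)
  then obtain t where t: "0 \<le> t" "t \<le> 1" "t - t ^ 3 / 9 = \<beta> * (8 / 9 * \<mu>)" by blast
  have "t \<noteq> 1" using t(3) \<beta>(2) by auto
  define z :: complex where "z = of_real (\<epsilon> * t)"
  have z: "z \<in> ball 0 1" using t \<epsilon> \<open>t \<noteq> 1\<close> by (auto simp: z_def norm_mult)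
  have "G z = of_real (1 / \<beta> * (\<epsilon> * t - (\<epsilon> * t) ^ 3 / 9))" by (simp add: G_def z_def)
  also have "\<epsilon> * t - (\<epsilon> * t) ^ 3 / 9 = \<epsilon> * (t - t ^ 3 / 9)"
    using \<epsilon> by (auto simp: power3_eq_cube)
  also have "1 / \<beta> * (\<epsilon> * (t - t ^ 3 / 9)) = \<epsilon> * (8 / 9 * \<mu>)"
    unfolding t(3) using \<beta>0 by simp
  finally have "exp (G z) = of_real (exp (\<epsilon> * (8 / 9 * \<mu>)))" by (simp only: exp_of_real)
  then show False using omit[OF w(1)[OF z]] w(2)[OF z] f(3)[OF z] by simp
qed

section \<open>Univalence of the targets and their omitted boundary values\<close>

lemma phi_Ne_props:
  "phi_Ne holomorphic_on A" "inj_on phi_Ne (ball 0 1)" "phi_Ne 0 = 1"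
  "norm w < 1 \<Longrightarrow> phi_Ne w \<noteq> 5 / 3"
proof -
  show "phi_Ne holomorphic_on A" unfolding phi_Ne_def by (intro holomorphic_intros) auto
  show "inj_on phi_Ne (ball 0 1)"
    using inj_on_cubic[of 1 3] by (simp add: phi_Ne_def inj_on_def algebra_simps)
  show "phi_Ne 0 = 1" by (simp add: phi_Ne_def)
  show "phi_Ne w \<noteq> 5 / 3" if "norm w < 1"
  proof
    assume "phi_Ne w = 5 / 3"
    then have "3 * phi_Ne w = 5" by (simp only:) simp
    then have "w ^ 3 = 3 * w - 2" by (simp add: phi_Ne_def algebra_simps)
    then have "(w - 1) * (w - 1) * (w + 2) = 0"
      by (simp add: power3_eq_cube algebra_simps)
    then have "w = 1 \<or> w = - 2" by (auto simp: add_eq_0_iff2)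
    then show False using that by auto
  qed
qed

lemma phi_S_props:
  "phi_S holomorphic_on A" "inj_on phi_S (ball 0 1)" "phi_S 0 = 1"
  "norm w < 1 \<Longrightarrow> phi_S w \<noteq> of_real (1 + sin 1)"
proof -
  show "phi_S holomorphic_on A" unfolding phi_S_def by (intro holomorphic_intros)
  \<comment> \<open>Any other solution has w - z or w + z of modulus at least pi > 2. The closed
    disk is allowed so that z = 1 can serve for the omitted value.\<close>
  have small: "w = z" if wz: "norm w \<le> 1" "norm z \<le> 1" and eq: "sin w = sin z" for w z :: complex
  proof -
    obtain n where n: "n \<in> \<int>" "w = z + of_real (2 * n * pi) \<or> w = - z + of_real ((2 * n + 1) * pi)"
      using eq unfolding complex_sin_eq by blast
    have ub: "norm (w - z) \<le> 2" "norm (w + z) \<le> 2"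
      using norm_triangle_ineq4[of w z] norm_triangle_ineq[of w z] wz by linarith+
    obtain k :: int where k: "n = of_int k" using n(1) by (rule Ints_cases)
    from n(2) show ?thesis
    proof
      assume "w = z + of_real (2 * n * pi)"
      moreover have "k = 0"
      proof (rule ccontr)
        assume "k \<noteq> 0"
        then have "\<bar>of_int k\<bar> \<ge> (1::real)" by linarith
        then have "\<bar>2 * n * pi\<bar> \<ge> 2 * 1 * 3"
          unfolding abs_mult k using pi_gt3 by (intro mult_mono) auto
        moreover have "norm (w - z) = \<bar>2 * n * pi\<bar>"
          using \<open>w = _\<close> by (simp only: add_diff_cancel_left' norm_of_real)
        ultimately show False using ub by simp
      qed
      ultimately show ?thesis using k by simp
    next
      assume "w = - z + of_real ((2 * n + 1) * pi)"
      moreover have "\<bar>(2 * n + 1) * pi\<bar> \<ge> 1 * 3"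
      proof -
        have "1 \<le> \<bar>2 * k + 1\<bar>" by presburger
        then have "real_of_int 1 \<le> of_int \<bar>2 * k + 1\<bar>" by (simp only: of_int_le_iff)
        then have "1 \<le> \<bar>2 * real_of_int k + 1\<bar>" by simp
        then show ?thesis
          unfolding abs_mult k using pi_gt3 by (intro mult_mono) auto
      qed
      ultimately have "norm (w + z) \<ge> 3" by (simp del: of_real_mult of_real_add)
      then show ?thesis using ub by simp
    qed
  qed
  show "inj_on phi_S (ball 0 1)"
    using small by (auto simp: phi_S_def inj_on_def)
  show "phi_S 0 = 1" by (simp add: phi_S_def)
  show "phi_S w \<noteq> of_real (1 + sin 1)" if "norm w < 1"
  proof
    assume "phi_S w = of_real (1 + sin 1)"
    then have "sin w = sin 1" by (simp add: phi_S_def sin_of_real[symmetric])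
    then have "w = 1" using small[of w 1] that by simp
    then show False using that by simp
  qed
qed

lemma phi_R_props:
  "phi_R holomorphic_on cball 0 1" "inj_on phi_R (ball 0 1)" "phi_R 0 = 1"
  "norm w < 1 \<Longrightarrow> phi_R w \<noteq> of_real (2 * sqrt 2 - 2)"
proof -
  define k :: complex where "k = of_real (1 + sqrt 2)"
  have k2: "k * k = 2 * k + 1"
    unfolding k_def by (simp flip: of_real_mult add: algebra_simps)
  have nk: "norm k = 1 + sqrt 2" by (simp add: k_def del: of_real_add)
  then have kn: "norm k > 1" by simp
  then have "k \<noteq> 0" by auto
  have phi: "phi_R z = 1 + z / k * ((k + z) / (k - z))" for z
    by (simp add: phi_R_def Let_def k_def)
  have ne: "k - z \<noteq> 0" if "norm z \<le> 1" for z using kn that by auto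
  show "phi_R holomorphic_on cball 0 1"
    unfolding phi using ne \<open>k \<noteq> 0\<close> by (intro holomorphic_intros) auto
  have frac: "phi_R z * (k * (k - z)) = k * k + z * z" if "norm z \<le> 1" for z
    using ne[OF that] \<open>k \<noteq> 0\<close> by (simp add: phi field_simps)
  show "phi_R 0 = 1" by (simp add: phi)
  show "inj_on phi_R (ball 0 1)"
  proof (rule inj_onI)
    fix a b assume ab: "a \<in> ball 0 1" "b \<in> ball 0 1" "phi_R a = phi_R b"
    have "(k * k + a * a) * (k * (k - b)) = (k * k + b * b) * (k * (k - a))"
      using frac[of a] frac[of b] ab by (simp flip: frac[of a] frac[of b] add: mult_ac)
    then have "k * ((a - b) * (k * k + k * (a + b) - a * b)) = 0"
      by (simp add: algebra_simps)
    \<comment> \<open>The subtracted terms stay below 1 + 2 k = k^2 in modulus; equality would occur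
      at a = b = -1, the critical point of \<open>phi_R\<close> on the circle.\<close>
    moreover have "k * k + k * (a + b) - a * b \<noteq> 0"
    proof
      assume "k * k + k * (a + b) - a * b = 0"
      then have "k * k = a * b - k * (a + b)" by (simp add: algebra_simps)
      then have "norm k * norm k = norm (a * b - k * (a + b))" by (metis norm_mult)
      also have "\<dots> \<le> norm a * norm b + norm k * (norm a + norm b)"
        by (intro order_trans[OF norm_triangle_ineq4] add_mono)
          (auto simp: norm_mult intro!: mult_left_mono norm_triangle_ineq)
      also have "\<dots> < 1 * 1 + norm k * (1 + 1)"
        using ab kn by (intro add_strict_mono mult_strict_mono' mult_strict_left_mono) auto
      also have "\<dots> = norm k * norm k" by (simp add: nk algebra_simps)
      finally show False by simp
    qed
    ultimately show "a = b" using \<open>k \<noteq> 0\<close> by simp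
  qed
  show "phi_R w \<noteq> of_real (2 * sqrt 2 - 2)" if w: "norm w < 1"
  proof
    assume "phi_R w = of_real (2 * sqrt 2 - 2)"
    moreover have "of_real (2 * sqrt 2 - 2) * k = 2"
      unfolding k_def of_real_mult[symmetric] by (simp add: algebra_simps)
    ultimately have "2 * (k - w) = k * k + w * w"
      using frac[of w] w by (simp flip: mult.assoc)
    then have "(w + 1) * (w + 1) = 0" using k2 by (simp add: algebra_simps)
    then have "w = - 1" by (simp add: add_eq_0_iff2)
    then show False using w by simp
  qed
qed

theorem corollary5p2:
  shows "(\<forall>\<beta>::real. \<forall>f\<in>class_A. subordinate (beta_expr \<beta> f) phi_Ne \<longrightarrow>
            (\<beta> \<ge> bound_S \<longrightarrow> f \<in> starlike_class phi_S) \<and>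
            (\<beta> \<ge> bound_R \<longrightarrow> f \<in> starlike_class phi_R) \<and>
            (\<beta> \<ge> bound_Ne \<longrightarrow> f \<in> starlike_class phi_Ne))
       \<and> (\<forall>c<bound_S. \<not> (\<forall>\<beta>\<ge>c. \<forall>f\<in>class_A.
            subordinate (beta_expr \<beta> f) phi_Ne \<longrightarrow> f \<in> starlike_class phi_S))
       \<and> (\<forall>c<bound_R. \<not> (\<forall>\<beta>\<ge>c. \<forall>f\<in>class_A.
            subordinate (beta_expr \<beta> f) phi_Ne \<longrightarrow> f \<in> starlike_class phi_R))
       \<and> (\<forall>c<bound_Ne. \<not> (\<forall>\<beta>\<ge>c. \<forall>f\<in>class_A.
            subordinate (beta_expr \<beta> f) phi_Ne \<longrightarrow> f \<in> starlike_class phi_Ne))"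
proof -
  \<comment> \<open>The factor 9/8 is the inverse of Q(1), so the right end of the region is
    \<open>E\<close> and the left end 1 / \<open>E\<close>. For \<open>phi_R\<close> the left end is
    the one attained, whence E = 1 / (2 sqrt 2 - 2).\<close>
  define \<mu> where "\<mu> E = 9 / 8 * ln E" for E :: real
  have \<mu>: "\<mu> E > 0" "exp (8 / 9 * \<mu> E) = E" "exp (- (8 / 9 * \<mu> E)) = 1 / E" if "E > 1" for E
    using that by (simp_all add: \<mu>_def exp_minus field_simps)
  have E: "1 + sin 1 > (1::real)" "(1 + sqrt 2) / 2 > (1::real)" "5 / 3 > (1::real)"
    using sin_gt_zero[of 1] pi_gt3 by auto
  have inv: "1 / ((1 + sqrt 2) / 2) = 2 * sqrt 2 - 2"
  proof -
    have "1 = (2 * sqrt 2 - 2) * ((1 + sqrt 2) / 2)" by (simp add: algebra_simps)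
    moreover have "(1 + sqrt 2) / 2 \<noteq> 0" using E(2) by linarith
    ultimately show ?thesis by (intro divide_eq_imp)
  qed
  have bounds: "bound_S = 1 / \<mu> (1 + sin 1)" "bound_Ne = 1 / \<mu> (5 / 3)"
    "bound_R = 1 / \<mu> ((1 + sqrt 2) / 2)"
  proof -
    show "bound_S = 1 / \<mu> (1 + sin 1)" "bound_Ne = 1 / \<mu> (5 / 3)"
      by (simp_all add: bound_S_def bound_Ne_def \<mu>_def)
    have "ln (2 * sqrt 2 - 2) = - ln ((1 + sqrt 2) / 2)"
      using E(2) ln_inverse[of "(1 + sqrt 2) / 2"] inv by (simp add: inverse_eq_divide)
    then show "bound_R = 1 / \<mu> ((1 + sqrt 2) / 2)"
      by (simp add: bound_R_def \<mu>_def)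
  qed
  have mult: "\<beta> * \<mu> E \<ge> 1" if "\<beta> \<ge> 1 / \<mu> E" "E > 1" for \<beta> E
    using that \<mu>(1)[of E] by (simp add: field_simps)
  have S: "f \<in> starlike_class phi_S"
    if "f \<in> class_A" "subordinate (beta_expr \<beta> f) phi_Ne" "\<beta> \<ge> bound_S" for \<beta> f
    using that E(1) \<mu>[OF E(1)] mult[of "1 + sin 1" \<beta>]
    by (intro starlike_class_if_avoids_boundary[of f \<beta> "\<mu> (1 + sin 1)"] phi_S_props
        exp_cubic_avoids_phi_S holomorphic_on_imp_continuous_on) (auto simp: bounds)
  have R: "f \<in> starlike_class phi_R"
    if "f \<in> class_A" "subordinate (beta_expr \<beta> f) phi_Ne" "\<beta> \<ge> bound_R" for \<beta> f
    using that E(2) \<mu>[OF E(2)] mult[of "(1 + sqrt 2) / 2" \<beta>]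
    by (intro starlike_class_if_avoids_boundary[of f \<beta> "\<mu> ((1 + sqrt 2) / 2)"] phi_R_props
        holomorphic_on_subset[OF phi_R_props(1)] exp_cubic_avoids_phi_R
        holomorphic_on_imp_continuous_on) (auto simp: bounds)
  have Ne: "f \<in> starlike_class phi_Ne"
    if "f \<in> class_A" "subordinate (beta_expr \<beta> f) phi_Ne" "\<beta> \<ge> bound_Ne" for \<beta> f
    using that E(3) \<mu>[OF E(3)] mult[of "5 / 3" \<beta>]
    by (intro starlike_class_if_avoids_boundary[of f \<beta> "\<mu> (5 / 3)"] phi_Ne_props
        exp_cubic_avoids_phi_Ne holomorphic_on_imp_continuous_on) (auto simp: bounds)
  have S': "\<not> (\<forall>\<beta>\<ge>c. \<forall>f\<in>class_A. subordinate (beta_expr \<beta> f) phi_Ne \<longrightarrow> f \<in> starlike_class phi_S)"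
    if "c < bound_S" for c
    using that phi_S_props(4) \<mu>(2)[OF E(1)]
    by (intro starlike_bound_sharp[OF \<mu>(1)[OF E(1)], of _ 1]) (auto simp: bounds)
  have R': "\<not> (\<forall>\<beta>\<ge>c. \<forall>f\<in>class_A. subordinate (beta_expr \<beta> f) phi_Ne \<longrightarrow> f \<in> starlike_class phi_R)"
    if "c < bound_R" for c
  proof (rule starlike_bound_sharp[OF \<mu>(1)[OF E(2)], of _ "- 1"])
    have "exp (- 1 * (8 / 9 * \<mu> ((1 + sqrt 2) / 2))) = 2 * sqrt 2 - 2"
      using \<mu>(3)[OF E(2)] unfolding inv by simp
    then show "phi_R w \<noteq> of_real (exp (- 1 * (8 / 9 * \<mu> ((1 + sqrt 2) / 2))))" if "norm w < 1" for w
      using phi_R_props(4)[OF that] by (simp only:) simp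
  qed (use that in \<open>auto simp: bounds\<close>)
  have Ne': "\<not> (\<forall>\<beta>\<ge>c. \<forall>f\<in>class_A. subordinate (beta_expr \<beta> f) phi_Ne \<longrightarrow> f \<in> starlike_class phi_Ne)"
    if "c < bound_Ne" for c
  proof (rule starlike_bound_sharp[OF \<mu>(1)[OF E(3)], of _ 1])
    have "exp (1 * (8 / 9 * \<mu> (5 / 3))) = 5 / 3"
      using \<mu>(2)[OF E(3)] by simp
    then show "phi_Ne w \<noteq> of_real (exp (1 * (8 / 9 * \<mu> (5 / 3))))" if "norm w < 1" for w
      using phi_Ne_props(4)[OF that] by (simp only:) simp
  qed (use that in \<open>auto simp: bounds\<close>)
  show ?thesis using S R Ne S' R' Ne' by blast
qed

end
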